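(* Let $A$ and $E$ be real symmetric $n\times n$ matrices, $\tilde A=A+E$. Let $\lambda_1\ge\dots\ge\lambda_n$ be the eigenvalues of $A$ with a corresponding orthonormal basis of eigenvectors $u_1,\dots,u_n$, and let $\tilde\lambda_1\ge\dots\ge\tilde\lambda_n$ be the eigenvalues of $\tilde A$ with a corresponding orthonormal basis of eigenvectors $\tilde u_1,\dots,\tilde u_n$. Let $S$ be a nonempty proper subset of $\{1,\dots,n\}$ with $|S|=p$ and $$\delta_S:=\min_{i\in S,\,j\notin S}|\lambda_i-\lambda_j|>0.$$ Let $\bar\lambda\ge\delta_S$, and let $N=N_{\bar\lambda}(S)\subseteq\{1,\dots,n\}$ be a set of indices such that $\min_{i\in S}|\lambda_j-\lambda_i|>\bar\lambda$ for all $j\notin N$; put $r=|N|$. Let $\Gamma\subset\mathbb C$ be a simple closed contour having in its interior the eigenvalues $\lambda_i$, $i\in S$, and no other eigenvalue of $A$, such that the distance from every eigenvalue of $A$ to $\Gamma$ is at least $\delta_S/2$ and the distance from $\lambda_j$ to $\Gamma$ is at least $\bar\lambda/2$ for every $j\notin N$. Let $\tilde S=\{i:\tilde\lambda_i\text{ lies inside }\Gamma\}$, $\Pi_S=\sum_{i\in S}u_iu_i^T$ and $\tilde\Pi_{\tilde S}=\sum_{i\in\tilde S}\tilde u_i\tilde u_i^T$. With $x$, $y$, $w$ and $\|E\|_{A,S,\bar\lambda}=\sqrt r\,x+\sqrt r\,y$ as defined in the context, assume that $$\delta_S\ \ge\ \max\Big\{12\,r\,x,\ \frac{144\,r\,w^2}{\bar\lambda}\Big\}.$$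 Then $$\|\tilde\Pi_{\tilde S}-\Pi_S\|\ \le\ 12\sqrt p\,\frac{\|E\|_{A,S,\bar\lambda}}{\delta_S}+12\sqrt p\,\frac{\|E\|}{\bar\lambda}.$$
   Context: $\|\cdot\|$ is the spectral (operator) norm for matrices and the Euclidean norm for vectors. Note that $N$ is allowed to contain indices $i$ with $\min_{s\in S}|\lambda_i-\lambda_s|>\bar\lambda$. Define - $x:=\max_{i,j\in N}|u_i^TEu_j|$; - $y:=\max_{i,j\in N,\ i\ne j,\ k\in S}\Big|u_i^TE\Big(\sum_{l\notin N}\dfrac{u_lu_l^T}{\lambda_k-\lambda_l}\Big)Eu_j\Big|$ (a maximum over an empty set and an empty sum are $0$); - $w:=\max_{i\in N}\|u_i^TE\|$. The relative norm is $\|E\|_{A,S,\bar\lambda}:=\sqrt r\,x+\sqrt r\,y$. *)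

theory Defs
  imports "HOL-Analysis.Analysis"
begin

text \<open>
  Eigenvalues and eigenvectors of an \<open>n \<times> n\<close> matrix are families indexed by \<open>nat\<close>, of
  which only the members with index in \<open>{1..n}\<close>, where \<open>n = CARD('n)\<close>, are relevant.
  Complements of index sets are always taken in \<open>{1..n}\<close>.
\<close>

text \<open>
  \<open>n\<close> orthonormal vectors form a basis, so the list \<open>ev 1 \<ge> \<dots> \<ge> ev n\<close> below consists of all
  eigenvalues of \<open>M\<close>, repeated according to multiplicity.
\<close>

definition ordered_eigenbasis ::
    "real^'n^'n \<Rightarrow> (nat \<Rightarrow> real) \<Rightarrow> (nat \<Rightarrow> real^'n) \<Rightarrow> bool" where
  "ordered_eigenbasis M ev u \<longleftrightarrow>
     (\<forall>i\<in>{1..CARD('n)}. M *v u i = ev i *\<^sub>R u i) \<and>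
     (\<forall>i\<in>{1..CARD('n)}. \<forall>j\<in>{1..CARD('n)}. u i \<bullet> u j = (if i = j then 1 else 0)) \<and>
     (\<forall>i\<in>{1..CARD('n)}. \<forall>j\<in>{1..CARD('n)}. i \<le> j \<longrightarrow> ev j \<le> ev i)"

abbreviation spectral_norm :: "real^'n^'n \<Rightarrow> real" where
  "spectral_norm M \<equiv> onorm (\<lambda>v. M *v v)"

definition outer_product :: "real^'n \<Rightarrow> real^'n \<Rightarrow> real^'n^'n" where
  "outer_product v v' = (\<chi> i j. v $ i * v' $ j)"

definition spectral_projection :: "(nat \<Rightarrow> real^'n) \<Rightarrow> nat set \<Rightarrow> real^'n^'n" where
  "spectral_projection u S = (\<Sum>i\<in>S. outer_product (u i) (u i))"

text \<open>The convention that a maximum over the empty set is \<open>0\<close>; \<open>Max {}\<close> is unspecified.\<close>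

definition Max0 :: "real set \<Rightarrow> real" where
  "Max0 X = (if X = {} then 0 else Max X)"

definition spectral_gap :: "nat \<Rightarrow> (nat \<Rightarrow> real) \<Rightarrow> nat set \<Rightarrow> real" where
  "spectral_gap n ev S = Min {\<bar>ev i - ev j\<bar> | i j. i \<in> S \<and> j \<in> {1..n} - S}"

definition x_param :: "real^'n^'n \<Rightarrow> (nat \<Rightarrow> real^'n) \<Rightarrow> nat set \<Rightarrow> real" where
  "x_param E u N = Max0 {\<bar>u i \<bullet> (E *v u j)\<bar> | i j. i \<in> N \<and> j \<in> N}"

definition y_param ::
    "real^'n^'n \<Rightarrow> (nat \<Rightarrow> real) \<Rightarrow> (nat \<Rightarrow> real^'n) \<Rightarrow> nat set \<Rightarrow> nat set \<Rightarrow> real" where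
  "y_param E ev u S N = Max0
     {\<bar>u i \<bullet> ((E ** (\<Sum>l\<in>{1..CARD('n)} - N. (1 / (ev k - ev l)) *\<^sub>R outer_product (u l) (u l)) ** E)
         *v u j)\<bar>
      | i j k. i \<in> N \<and> j \<in> N \<and> i \<noteq> j \<and> k \<in> S}"

definition w_param :: "real^'n^'n \<Rightarrow> (nat \<Rightarrow> real^'n) \<Rightarrow> nat set \<Rightarrow> real" where
  "w_param E u N = Max0 {norm (u i v* E) | i. i \<in> N}"

text \<open>\<open>A\<close> enters the relative norm through \<open>ev\<close> and \<open>u\<close>, the cut-off through \<open>N\<close>.\<close>

definition relative_norm ::
    "real^'n^'n \<Rightarrow> (nat \<Rightarrow> real) \<Rightarrow> (nat \<Rightarrow> real^'n) \<Rightarrow> nat set \<Rightarrow> nat set \<Rightarrow> real" where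
  "relative_norm E ev u S N =
     sqrt (real (card N)) * x_param E u N + sqrt (real (card N)) * y_param E ev u S N"

definition simple_closed_contour :: "(real \<Rightarrow> complex) \<Rightarrow> bool" where
  "simple_closed_contour \<gamma> \<longleftrightarrow> valid_path \<gamma> \<and> simple_path \<gamma> \<and> pathfinish \<gamma> = pathstart \<gamma>"

end

theory Submission
  imports Defs
begin

text \<open>
  Why the theorem holds. Write \<open>P\<close>, \<open>P'\<close> for the spectral projections of \<open>A\<close> and \<open>A + E\<close>,
  \<open>M\<close> for the complement of \<open>N\<close>, \<open>\<Lambda>\<close> for the cut-off and \<open>e\<close> for the norm of \<open>E\<close>. The contour
  enters only through its sides: a ball around an eigenvalue \<open>ev j\<close> that misses the contour lies
  wholly on the side of \<open>ev j\<close>. Hence eigenvalues \<open>ev' i\<close> and \<open>ev j\<close> on different sides are at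
  distance at least \<open>\<delta> / 2\<close>, and at least \<open>\<Lambda> / 2\<close> if \<open>j\<close> is in \<open>M\<close>. These distances
  feed residual estimates between the two eigenbases.

  If \<open>6 * e > \<Lambda>\<close>, the right-hand side exceeds \<open>2\<close> and there is nothing to prove. Otherwise each
  \<open>u k\<close> with \<open>k\<close> in \<open>S\<close> has a correction \<open>z\<^sub>k\<close> in the span of the \<open>u l\<close>, \<open>l\<close> in \<open>M\<close>, such that
  the residual \<open>(A + E - ev k) (u k + z\<^sub>k)\<close> has no component in \<open>M\<close>; it is then the \<open>N\<close>-part of
  \<open>E (u k + z\<^sub>k)\<close>. To first order \<open>z\<^sub>k\<close> is the resolvent expression occurring in the definition
  of \<open>y\<close>, so the entries of the residual off the position \<open>k\<close> are at most \<open>x + y\<close> up to a term of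
  second order (lemma \<open>norm_offdiag\<close>). The part of the entry at position \<open>k\<close> that \<open>x\<close> and \<open>y\<close> do
  not control multiplies \<open>u k\<close> itself and is absorbed because \<open>w\<close> is small.

  The difference of the projections is split as \<open>P' - P = (1 - P) P' - P (1 - P')\<close>. The second term
  is controlled by testing the residuals against the new eigenvectors outside \<open>S'\<close> (lemma
  \<open>old_vector_outside\<close>). For the first, every new eigenvector with index in \<open>S'\<close> is expanded in
  the corrected vectors, a part in \<open>N - S\<close> and a remainder in \<open>M\<close>; the eigenvalue equation gives
  two coupled inequalities for the latter two parts (lemmas \<open>new_vector_near\<close> and
  \<open>new_vector_far\<close>), which close up because \<open>x\<close> and \<open>w\<close> are small. Summing squares over \<open>S'\<close>
  costs only a factor \<open>sqrt p\<close>, whatever the size of \<open>S'\<close>: the sums are bounded by Hilbert-Schmidt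
  norms of operators that factor through the \<open>p\<close>-dimensional range of \<open>P\<close> (lemma
  \<open>hilbert_schmidt_bound\<close>).
\<close>

section \<open>Orthonormal bases and coordinate projections\<close>

lemma L2_set_const_bound:
  assumes "\<And>k. k \<in> T \<Longrightarrow> f k \<le> c" "\<And>k. k \<in> T \<Longrightarrow> 0 \<le> f k" "0 \<le> c"
  shows "L2_set f T \<le> sqrt (card T) * c"
  using L2_set_mono[of T f "\<lambda>_. c"] assms by (simp add: L2_set_constant)

locale orthonormal_basis =
  fixes I :: "'i set" and u :: "'i \<Rightarrow> 'a::euclidean_space"
  assumes finite_index: "finite I"
    and inner_basis: "\<And>i j. i \<in> I \<Longrightarrow> j \<in> I \<Longrightarrow> u i \<bullet> u j = (if i = j then 1 else 0)"
    and expansion: "\<And>v. (\<Sum>i\<in>I. (u i \<bullet> v) *\<^sub>R u i) = v"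
begin

definition proj :: "'i set \<Rightarrow> 'a \<Rightarrow> 'a" where
  "proj S v = (\<Sum>i\<in>S. (u i \<bullet> v) *\<^sub>R u i)"

lemma linear_proj: "linear (proj S)"
  unfolding proj_def
  by (rule linearI)
    (simp_all add: inner_add_right scaleR_add_left sum.distrib scaleR_sum_right)

lemma inner_combination:
  assumes "S \<subseteq> I" "j \<in> I"
  shows "u j \<bullet> (\<Sum>i\<in>S. c i *\<^sub>R u i) = (if j \<in> S then c j else 0)"
proof -
  have fin: "finite S" using assms(1) finite_index finite_subset by blast
  have "u j \<bullet> (\<Sum>i\<in>S. c i *\<^sub>R u i) = (\<Sum>i\<in>S. c i * (u j \<bullet> u i))"
    by (simp add: inner_sum_right)
  also have "\<dots> = (\<Sum>i\<in>S. if j = i then c i else 0)"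
    using assms by (intro sum.cong) (auto simp: inner_basis)
  finally show ?thesis using fin by simp
qed

lemma inner_proj:
  assumes "S \<subseteq> I" "j \<in> I"
  shows "u j \<bullet> proj S v = (if j \<in> S then u j \<bullet> v else 0)"
  unfolding proj_def by (rule inner_combination[OF assms])

lemma coordinates_eqI:
  assumes "\<And>i. i \<in> I \<Longrightarrow> u i \<bullet> v = u i \<bullet> w"
  shows "v = w"
  using expansion[of v] expansion[of w] assms by (metis (no_types, lifting) sum.cong)

lemma norm_combination:
  assumes "S \<subseteq> I"
  shows "norm (\<Sum>i\<in>S. c i *\<^sub>R u i) = L2_set c S"
proof -
  have "(norm (\<Sum>i\<in>S. c i *\<^sub>R u i))\<^sup>2
      = (\<Sum>j\<in>S. c j * (u j \<bullet> (\<Sum>i\<in>S. c i *\<^sub>R u i)))"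
    by (simp add: power2_norm_eq_inner inner_sum_left)
  also have "\<dots> = (\<Sum>j\<in>S. (c j)\<^sup>2)"
    by (rule sum.cong[OF refl]) (use assms inner_combination[OF assms] in \<open>auto simp: power2_eq_square\<close>)
  finally show ?thesis
    by (metis L2_set_def norm_ge_zero real_sqrt_unique)
qed

lemma norm_proj: "S \<subseteq> I \<Longrightarrow> norm (proj S v) = L2_set (\<lambda>i. u i \<bullet> v) S"
  unfolding proj_def by (rule norm_combination)

lemma norm_coordinates: "norm v = L2_set (\<lambda>i. u i \<bullet> v) I"
  using norm_proj[of I v] by (simp add: proj_def expansion)

lemma proj_self_adjoint: "proj S v \<bullet> w = v \<bullet> proj S w"
  by (simp add: proj_def inner_sum_left inner_sum_right inner_commute mult.commute)

lemma proj_idem: "S \<subseteq> I \<Longrightarrow> proj S (proj S v) = proj S v"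
  by (rule coordinates_eqI) (simp add: inner_proj)

lemma proj_add: "proj S (v + w) = proj S v + proj S w"
  by (rule linear_add[OF linear_proj])

lemma norm_proj_mono:
  assumes "S \<subseteq> T" "T \<subseteq> I"
  shows "norm (proj S v) \<le> norm (proj T v)"
proof -
  have "finite T" using assms(2) finite_index finite_subset by blast
  then have "L2_set (\<lambda>i. u i \<bullet> v) S \<le> L2_set (\<lambda>i. u i \<bullet> v) T"
    unfolding L2_set_def using assms(1) by (intro real_sqrt_le_mono sum_mono2) auto
  then show ?thesis using assms by (simp add: norm_proj)
qed

lemma norm_proj_le: "S \<subseteq> I \<Longrightarrow> norm (proj S v) \<le> norm v"
  using norm_proj_mono[of S I v] by (simp add: proj_def expansion)

lemma proj_split:
  assumes "S \<subseteq> T" "T \<subseteq> I"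
  shows "proj T v = proj S v + proj (T - S) v"
  unfolding proj_def using assms finite_index
  by (subst add.commute, intro sum.subset_diff) (auto intro: finite_subset)

lemma proj_split_full: "S \<subseteq> I \<Longrightarrow> v = proj S v + proj (I - S) v"
  using proj_split[of S I v] by (simp add: proj_def expansion)

text \<open>
  Turns a coordinatewise eigenvalue equation with gap \<open>c\<close> into a norm estimate.
\<close>

lemma norm_proj_scale:
  assumes "S \<subseteq> I" "0 \<le> c" "\<And>i. i \<in> S \<Longrightarrow> c * \<bar>u i \<bullet> v\<bar> \<le> \<bar>u i \<bullet> w\<bar>"
  shows "c * norm (proj S v) \<le> norm (proj S w)"
proof -
  have "c * L2_set (\<lambda>i. \<bar>u i \<bullet> v\<bar>) S = L2_set (\<lambda>i. c * \<bar>u i \<bullet> v\<bar>) S"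
    using assms(2) by (rule L2_set_right_distrib)
  also have "\<dots> \<le> L2_set (\<lambda>i. \<bar>u i \<bullet> w\<bar>) S"
    using assms by (intro L2_set_mono) auto
  finally show ?thesis using assms(1) by (simp add: norm_proj L2_set_def)
qed

lemma norm_proj_le_card:
  assumes "S \<subseteq> I" "0 \<le> c" "\<And>i. i \<in> S \<Longrightarrow> \<bar>u i \<bullet> v\<bar> \<le> c"
  shows "norm (proj S v) \<le> sqrt (card S) * c"
proof -
  have "L2_set (\<lambda>i. \<bar>u i \<bullet> v\<bar>) S \<le> L2_set (\<lambda>i. c) S"
    using assms by (intro L2_set_mono) auto
  also have "\<dots> = sqrt (card S) * c"
    using assms(2) by (simp add: L2_set_constant)
  finally show ?thesis using assms(1) by (simp add: norm_proj L2_set_def)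
qed

end

text \<open>
  The vectors on the left are the images of the \<open>u' i\<close> under \<open>\<Phi> \<circ> F\<close>, where \<open>\<Phi>\<close> sends \<open>u k\<close> to
  \<open>b k\<close> for \<open>k \<in> S\<close> and annihilates the other basis vectors. The left-hand side is thus at most the
  Hilbert-Schmidt norm of \<open>\<Phi> \<circ> F\<close>, which may be computed from the adjoint \<open>F \<circ> \<Phi>\<^sup>*\<close> instead; there
  the bound on \<open>F\<close> applies, and \<open>\<Phi>\<close> has Hilbert-Schmidt norm equal to that of the family \<open>b\<close>.
  The size of \<open>T\<close> does not enter.
\<close>

lemma hilbert_schmidt_bound:
  fixes u :: "'i \<Rightarrow> 'a::euclidean_space" and u' :: "'j \<Rightarrow> 'a" and b :: "'i \<Rightarrow> 'a"
  assumes "orthonormal_basis I u" "orthonormal_basis I' u'"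
    and S: "S \<subseteq> I" and T: "T \<subseteq> I'"
    and lin: "linear F" and sym: "\<And>v w. F v \<bullet> w = v \<bullet> F w"
    and bound: "\<And>v. norm (F v) \<le> e * norm v" and e: "0 \<le> e"
  shows "L2_set (\<lambda>i. norm (\<Sum>k\<in>S. (u k \<bullet> F (u' i)) *\<^sub>R b k)) T
          \<le> e * L2_set (\<lambda>k. norm (b k)) S"
proof -
  interpret U: orthonormal_basis I u by fact
  interpret U': orthonormal_basis I' u' by fact
  \<comment> \<open>\<open>c j\<close> is the adjoint of \<open>\<Phi>\<close> applied to \<open>u j\<close>.\<close>
  define c where "c j = (\<Sum>k\<in>S. (u j \<bullet> b k) *\<^sub>R u k)" for j
  have coord: "u j \<bullet> (\<Sum>k\<in>S. (u k \<bullet> F (u' i)) *\<^sub>R b k) = u' i \<bullet> F (c j)" for i j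
  proof -
    have "u' i \<bullet> F (c j) = F (u' i) \<bullet> c j" by (rule sym[symmetric])
    then show ?thesis
      by (simp add: c_def inner_sum_right inner_commute[of "F (u' i)"] mult.commute)
  qed
  have "(\<Sum>i\<in>T. (norm (\<Sum>k\<in>S. (u k \<bullet> F (u' i)) *\<^sub>R b k))\<^sup>2)
      = (\<Sum>i\<in>T. \<Sum>j\<in>I. (u' i \<bullet> F (c j))\<^sup>2)"
    by (simp add: U.norm_coordinates L2_set_def sum_nonneg coord)
  also have "\<dots> = (\<Sum>j\<in>I. (norm (U'.proj T (F (c j))))\<^sup>2)"
    by (subst sum.swap) (simp add: U'.norm_proj[OF T] L2_set_def sum_nonneg)
  also have "\<dots> \<le> (\<Sum>j\<in>I. (e * norm (c j))\<^sup>2)"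
  proof (intro sum_mono power_mono)
    fix j
    show "norm (U'.proj T (F (c j))) \<le> e * norm (c j)"
      using U'.norm_proj_le[OF T] bound order_trans by blast
  qed auto
  also have "\<dots> = e\<^sup>2 * (\<Sum>j\<in>I. \<Sum>k\<in>S. (u j \<bullet> b k)\<^sup>2)"
    unfolding c_def using S
    by (simp add: U.norm_combination L2_set_def sum_nonneg power_mult_distrib sum_distrib_left)
  also have "\<dots> = e\<^sup>2 * (\<Sum>k\<in>S. (norm (b k))\<^sup>2)"
    by (subst sum.swap) (simp add: U.norm_coordinates L2_set_def sum_nonneg)
  finally have "sqrt (\<Sum>i\<in>T. (norm (\<Sum>k\<in>S. (u k \<bullet> F (u' i)) *\<^sub>R b k))\<^sup>2)
      \<le> sqrt (e\<^sup>2 * (\<Sum>k\<in>S. (norm (b k))\<^sup>2))"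
    by (rule real_sqrt_le_mono)
  then show ?thesis using e by (simp add: L2_set_def real_sqrt_mult)
qed

section \<open>The perturbation setting\<close>

text \<open>
  The contour is replaced by what it implies for the distances between old and new eigenvalues,
  and the maxima \<open>x\<close>, \<open>y\<close>, \<open>w\<close> by upper bounds. The parameters \<open>\<Lambda>\<close> and \<open>e\<close> stand for the cut-off
  and for a bound on the norm of \<open>E\<close>.
\<close>

locale spectral_perturbation =
  U: orthonormal_basis I u + U': orthonormal_basis I' u'
  for I :: "'i set" and u :: "'i \<Rightarrow> 'a::euclidean_space"
    and I' :: "'j set" and u' :: "'j \<Rightarrow> 'a" +
  fixes A E :: "'a \<Rightarrow> 'a" and ev :: "'i \<Rightarrow> real" and ev' :: "'j \<Rightarrow> real"
    and S N :: "'i set" and S' :: "'j set"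
    and \<delta> \<Lambda> e x y w :: real
  assumes linear_A: "linear A" and linear_E: "linear E"
    and sym_A: "\<And>v w. A v \<bullet> w = v \<bullet> A w" and sym_E: "\<And>v w. E v \<bullet> w = v \<bullet> E w"
    and eigen: "\<And>i. i \<in> I \<Longrightarrow> A (u i) = ev i *\<^sub>R u i"
    and eigen': "\<And>i. i \<in> I' \<Longrightarrow> A (u' i) + E (u' i) = ev' i *\<^sub>R u' i"
    and index_sets: "S \<subseteq> N" "N \<subseteq> I" "S' \<subseteq> I'" "S \<noteq> {}"
    and gap: "0 < \<delta>" "\<delta> \<le> \<Lambda>"
    and far: "\<And>k l. k \<in> S \<Longrightarrow> l \<in> I - N \<Longrightarrow> \<Lambda> \<le> \<bar>ev k - ev l\<bar>"
    and sep_out: "\<And>i k. i \<in> I' - S' \<Longrightarrow> k \<in> S \<Longrightarrow> \<delta> / 2 \<le> \<bar>ev' i - ev k\<bar>"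
    and sep_in: "\<And>i j. i \<in> S' \<Longrightarrow> j \<in> I - S \<Longrightarrow> \<delta> / 2 \<le> \<bar>ev' i - ev j\<bar>"
    and sep_far: "\<And>i l. i \<in> S' \<Longrightarrow> l \<in> I - N \<Longrightarrow> \<Lambda> / 2 \<le> \<bar>ev' i - ev l\<bar>"
    and E_bound: "\<And>v. norm (E v) \<le> e * norm v" and e_nonneg: "0 \<le> e" and e_small: "6 * e \<le> \<Lambda>"
    and x_bound: "\<And>i j. i \<in> N \<Longrightarrow> j \<in> N \<Longrightarrow> \<bar>u i \<bullet> E (u j)\<bar> \<le> x"
    and w_bound: "\<And>i. i \<in> N \<Longrightarrow> norm (E (u i)) \<le> w"
    and y_bound: "\<And>j k. j \<in> N \<Longrightarrow> k \<in> S \<Longrightarrow> j \<noteq> k \<Longrightarrow>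
      \<bar>u j \<bullet> E (\<Sum>l\<in>I - N. ((u l \<bullet> E (u k)) / (ev k - ev l)) *\<^sub>R u l)\<bar> \<le> y"
    and y_nonneg: "0 \<le> y"
    and x_small: "12 * real (card N) * x \<le> \<delta>"
    and w_small: "144 * real (card N) * w\<^sup>2 \<le> \<delta> * \<Lambda>"
begin

lemma \<Lambda>_pos: "0 < \<Lambda>" using gap by linarith

lemma S_I: "S \<subseteq> I" and N_diff_S: "N - S \<subseteq> I" and M_I: "I - N \<subseteq> I"
  using index_sets by auto

lemma x_nonneg: "0 \<le> x"
proof -
  obtain k where "k \<in> N" using index_sets by blast
  then show ?thesis using x_bound[of k k] by linarith
qed

lemma w_nonneg: "0 \<le> w"
proof -
  obtain k where "k \<in> N" using index_sets by blast
  then show ?thesis using w_bound[of k] norm_ge_zero[of "E (u k)"] by linarith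
qed

lemma card_N: "1 \<le> real (card N)"
proof -
  have "finite N" "N \<noteq> {}" using index_sets U.finite_index by (auto intro: finite_subset)
  then show ?thesis by (simp add: Suc_leI card_gt_0_iff)
qed

lemma sqrt_N_w: "12 * (sqrt (card N) * w) \<le> \<Lambda>"
proof -
  have "(12 * (sqrt (card N) * w))\<^sup>2 = 144 * real (card N) * w\<^sup>2"
    by (simp add: power_mult_distrib)
  also have "\<dots> \<le> \<delta> * \<Lambda>" by (rule w_small)
  also have "\<dots> \<le> \<Lambda>\<^sup>2"
    unfolding power2_eq_square using gap by (intro mult_right_mono) auto
  finally show ?thesis using \<Lambda>_pos by (rule power2_le_imp_le[OF _ less_imp_le])
qed

text \<open>
  In the second-order terms one factor \<open>w\<close> comes from the rows with index in \<open>N\<close>, together with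
  \<open>sqrt (card N)\<close>, and the other from a single correction vector.
\<close>

lemma sqrt_N_w_w: "144 * (sqrt (card N) * w * w) \<le> \<delta> * \<Lambda>"
proof -
  have "sqrt (card N) \<le> card N"
  proof (rule real_le_lsqrt)
    show "real (card N) \<le> (real (card N))\<^sup>2" using card_N by (rule self_le_power) simp
  qed simp
  then have "sqrt (card N) * w\<^sup>2 \<le> card N * w\<^sup>2" by (intro mult_right_mono) auto
  with w_small show ?thesis by (simp add: power2_eq_square mult.assoc)
qed

lemma inner_A: "j \<in> I \<Longrightarrow> u j \<bullet> A v = ev j * (u j \<bullet> v)"
  by (simp add: sym_A[symmetric] eigen)

lemma inner_A':
  assumes "i \<in> I'"
  shows "u' i \<bullet> (A v + E v) = ev' i * (u' i \<bullet> v)"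
proof -
  have "u' i \<bullet> (A v + E v) = (A (u' i) + E (u' i)) \<bullet> v"
    unfolding inner_add_right inner_add_left sym_A sym_E ..
  then show ?thesis using eigen'[OF assms] by simp
qed

lemma eigen'_coordinates:
  assumes "i \<in> I'" "j \<in> I"
  shows "(ev' i - ev j) * (u j \<bullet> u' i) = u j \<bullet> E (u' i)"
  using arg_cong[OF eigen'[OF assms(1)], of "\<lambda>v. u j \<bullet> v"] inner_A[OF assms(2), of "u' i"]
  by (simp add: inner_add_right algebra_simps)

lemma E_proj_N:
  assumes "T \<subseteq> N"
  shows "norm (U.proj T (E v)) \<le> sqrt (card N) * w * norm v"
proof -
  have "norm (U.proj T (E v)) \<le> norm (U.proj N (E v))"
    using assms index_sets by (intro U.norm_proj_mono)
  also have "\<dots> \<le> sqrt (card N) * (w * norm v)"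
  proof (rule U.norm_proj_le_card)
    fix i assume "i \<in> N"
    have "\<bar>u i \<bullet> E v\<bar> \<le> norm (E (u i)) * norm v"
      unfolding sym_E[symmetric] by (rule Cauchy_Schwarz_ineq2)
    also have "\<dots> \<le> w * norm v" using w_bound[OF \<open>i \<in> N\<close>] by (intro mult_right_mono) auto
    finally show "\<bar>u i \<bullet> E v\<bar> \<le> w * norm v" .
  qed (use index_sets w_nonneg in auto)
  finally show ?thesis by (simp add: mult.assoc)
qed

text \<open>
  The adjoint of \<open>E_proj_N\<close>, with the same constant: test \<open>E g\<close> against itself and move \<open>E\<close> across.
\<close>

lemma E_of_N_part:
  assumes "T \<subseteq> N"
  shows "norm (E (U.proj T v)) \<le> sqrt (card N) * w * norm (U.proj T v)"
proof -
  define g h where "g = U.proj T v" and "h = E g"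
  have g: "U.proj T g = g" using assms index_sets by (simp add: g_def U.proj_idem)
  have "norm h * norm h = E h \<bullet> g"
    by (simp add: h_def sym_E power2_norm_eq_inner flip: power2_eq_square)
  also have "\<dots> = U.proj T (E h) \<bullet> g" by (simp add: U.proj_self_adjoint g)
  also have "\<dots> \<le> norm (U.proj T (E h)) * norm g" by (rule norm_cauchy_schwarz)
  also have "\<dots> \<le> (sqrt (card N) * w * norm h) * norm g"
    using E_proj_N[OF assms] by (intro mult_right_mono) auto
  finally have "norm h * norm h \<le> norm h * (sqrt (card N) * w * norm g)"
    by (simp add: mult_ac)
  then have "norm h \<le> sqrt (card N) * w * norm g"
    using w_nonneg by (cases "norm h = 0") auto
  then show ?thesis by (simp add: g_def h_def)
qed

text \<open>
  All entries of the block of \<open>E\<close> on \<open>N\<close> are at most \<open>x\<close>, so its norm is at most \<open>card N * x\<close>.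
\<close>

lemma E_block_N:
  assumes T: "T \<subseteq> N"
  shows "12 * norm (U.proj T (E (U.proj T v))) \<le> \<delta> * norm (U.proj T v)"
proof -
  have TI: "T \<subseteq> I" using T index_sets by auto
  let ?g = "U.proj T v"
  have coord: "\<bar>u j \<bullet> E ?g\<bar> \<le> x * (sqrt (card T) * norm ?g)" if j: "j \<in> T" for j
  proof -
    have "u j \<bullet> E ?g = (\<Sum>l\<in>T. (u l \<bullet> v) * (u j \<bullet> E (u l)))"
      by (simp add: U.proj_def linear_sum[OF linear_E] linear_cmul[OF linear_E] inner_sum_right)
    also have "\<bar>\<dots>\<bar> \<le> (\<Sum>l\<in>T. \<bar>u l \<bullet> v\<bar> * \<bar>x\<bar>)"
    proof (rule order_trans[OF sum_abs], rule sum_mono)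
      fix l assume "l \<in> T"
      then have "\<bar>u j \<bullet> E (u l)\<bar> \<le> \<bar>x\<bar>" using x_bound[of j l] j T by fastforce
      then show "\<bar>(u l \<bullet> v) * (u j \<bullet> E (u l))\<bar> \<le> \<bar>u l \<bullet> v\<bar> * \<bar>x\<bar>"
        unfolding abs_mult by (intro mult_left_mono) auto
    qed
    also have "\<dots> \<le> L2_set (\<lambda>l. u l \<bullet> v) T * L2_set (\<lambda>_. x) T"
      by (rule L2_set_mult_ineq)
    also have "\<dots> = x * (sqrt (card T) * norm ?g)"
      using x_nonneg by (simp add: L2_set_constant U.norm_proj[OF TI])
    finally show ?thesis .
  qed
  have "norm (U.proj T (E ?g)) \<le> sqrt (card T) * (x * (sqrt (card T) * norm ?g))"
    using coord x_nonneg by (intro U.norm_proj_le_card[OF TI]) auto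
  also have "\<dots> = (sqrt (card T) * sqrt (card T)) * x * norm ?g" by (simp only: mult_ac)
  also have "\<dots> = card T * x * norm ?g" by simp
  also have "\<dots> \<le> card N * x * norm ?g"
    using card_mono[OF finite_subset[OF index_sets(2) U.finite_index] T] x_nonneg
    by (intro mult_right_mono) auto
  finally have "12 * norm (U.proj T (E ?g)) \<le> (12 * real (card N) * x) * norm ?g" by simp
  also have "\<dots> \<le> \<delta> * norm ?g" using x_small by (intro mult_right_mono) auto
  finally show ?thesis .
qed

section \<open>Corrected eigenvectors\<close>

text \<open>
  The equation says that \<open>(A + E - ev k) (u k + z)\<close> has no component outside \<open>N\<close>.
\<close>

definition is_correction :: "'i \<Rightarrow> 'a \<Rightarrow> bool" where
  "is_correction k z \<longleftrightarrow> (\<forall>j\<in>N. u j \<bullet> z = 0) \<and>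
     (\<forall>l\<in>I - N. (ev k - ev l) * (u l \<bullet> z) = u l \<bullet> E (u k + z))"

lemma norm_far_part:
  assumes "\<And>j. j \<in> N \<Longrightarrow> u j \<bullet> z = 0"
  shows "norm z = norm (U.proj (I - N) z)"
proof -
  have "z = U.proj (I - N) z"
    by (rule U.coordinates_eqI) (use assms in \<open>auto simp: U.inner_proj\<close>)
  then show ?thesis by simp
qed

text \<open>
  On the span of the \<open>u l\<close> with \<open>l \<in> I - N\<close> the operator \<open>ev k - A\<close> expands norms by at least
  \<open>\<Lambda>\<close>, while \<open>E\<close> contributes at most \<open>e < \<Lambda>\<close>. The operator acting on \<open>z\<close> is therefore injective,
  hence surjective in finite dimension. Extending the operator by the identity on the span of the \<open>u j\<close>,
  \<open>j \<in> N\<close>, makes it an endomorphism of the whole space.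
\<close>

lemma correction_exists:
  assumes k: "k \<in> S"
  shows "\<exists>z. is_correction k z"
proof -
  define L where "L z = U.proj N z + U.proj (I - N) (ev k *\<^sub>R z - A z - E z)" for z
  have lin: "linear L"
    unfolding L_def
    by (rule linearI)
      (simp_all add: linear_add[OF U.linear_proj] linear_add[OF linear_A] linear_add[OF linear_E]
        linear_cmul[OF U.linear_proj] linear_cmul[OF linear_A] linear_cmul[OF linear_E]
        linear_diff[OF U.linear_proj] algebra_simps)
  have coord: "u j \<bullet> L z = (if j \<in> N then u j \<bullet> z
      else (ev k - ev j) * (u j \<bullet> z) - u j \<bullet> E z)" if "j \<in> I" for j z
    using that index_sets M_I
    by (auto simp: L_def inner_add_right inner_diff_right U.inner_proj inner_A algebra_simps)
  have "inj L"
    unfolding linear_injective_0[OF lin]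
  proof (intro allI impI)
    fix z assume Lz: "L z = 0"
    have zN: "u j \<bullet> z = 0" if "j \<in> N" for j
      using coord[of j z] that index_sets Lz by auto
    have "\<Lambda> * norm (U.proj (I - N) z) \<le> norm (U.proj (I - N) (E z))"
    proof (rule U.norm_proj_scale)
      fix l assume l: "l \<in> I - N"
      have "(ev k - ev l) * (u l \<bullet> z) = u l \<bullet> E z"
        using coord[of l z] l Lz by auto
      then show "\<Lambda> * \<bar>u l \<bullet> z\<bar> \<le> \<bar>u l \<bullet> E z\<bar>"
        using far[OF k l] by (metis abs_ge_zero abs_mult mult_right_mono)
    qed (use \<Lambda>_pos in auto)
    also have "\<dots> \<le> e * norm z"
      using U.norm_proj_le[OF M_I] E_bound order_trans by blast
    finally have "\<Lambda> * norm z \<le> e * norm z" using norm_far_part[OF zN] by simp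
    then show "z = 0"
      using e_small \<Lambda>_pos by (auto simp: mult_le_cancel_right)
  qed
  with lin have "surj L" by (rule linear_injective_imp_surjective) simp
  then obtain z where z: "L z = U.proj (I - N) (E (u k))" by (metis surjD)
  have "u j \<bullet> z = 0" if "j \<in> N" for j
    using coord[of j z] that index_sets M_I by (auto simp: z U.inner_proj)
  moreover have "(ev k - ev l) * (u l \<bullet> z) = u l \<bullet> E (u k + z)" if "l \<in> I - N" for l
    using coord[of l z] that M_I
    by (auto simp: z U.inner_proj linear_add[OF linear_E] inner_add_right)
  ultimately show ?thesis unfolding is_correction_def by blast
qed

definition correction :: "'i \<Rightarrow> 'a" where
  "correction k = (SOME z. is_correction k z)"

lemma correction:
  assumes "k \<in> S"
  shows correction_near: "\<And>j. j \<in> N \<Longrightarrow> u j \<bullet> correction k = 0"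
    and correction_far: "\<And>l. l \<in> I - N \<Longrightarrow>
      (ev k - ev l) * (u l \<bullet> correction k) = u l \<bullet> E (u k + correction k)"
proof -
  have "is_correction k (correction k)"
    unfolding correction_def using correction_exists[OF assms] by (rule someI_ex)
  then show "\<And>j. j \<in> N \<Longrightarrow> u j \<bullet> correction k = 0"
    and "\<And>l. l \<in> I - N \<Longrightarrow>
      (ev k - ev l) * (u l \<bullet> correction k) = u l \<bullet> E (u k + correction k)"
    unfolding is_correction_def by auto
qed

lemma residual:
  assumes "k \<in> S"
  shows "A (u k + correction k) + E (u k + correction k) - ev k *\<^sub>R (u k + correction k)
    = U.proj N (E (u k + correction k))"
proof (rule U.coordinates_eqI)
  fix j assume j: "j \<in> I"
  have kI: "k \<in> I" "k \<in> N" using assms index_sets by auto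
  show "u j \<bullet> (A (u k + correction k) + E (u k + correction k) - ev k *\<^sub>R (u k + correction k))
    = u j \<bullet> U.proj N (E (u k + correction k))"
  proof (cases "j \<in> N")
    case True
    then have "(ev j - ev k) * (u j \<bullet> (u k + correction k)) = 0"
      using correction_near[OF assms] j kI by (simp add: inner_add_right U.inner_basis)
    with True show ?thesis
      using j index_sets
      by (simp add: inner_add_right[of _ "A _"] inner_diff_right inner_A U.inner_proj algebra_simps)
  next
    case False
    then have "u j \<bullet> u k = 0" using j kI by (auto simp: U.inner_basis)
    then have "(ev k - ev j) * (u j \<bullet> (u k + correction k)) = u j \<bullet> E (u k + correction k)"
      using correction_far[OF assms, of j] j False by (simp add: inner_add_right)
    with False show ?thesis
      using j index_sets
      by (simp add: inner_add_right[of _ "A _"] inner_diff_right inner_A U.inner_proj algebra_simps)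
  qed
qed

text \<open>
  The factor \<open>6 / 5\<close> is \<open>1 / (1 - e / \<Lambda>)\<close> at the extreme value \<open>e = \<Lambda> / 6\<close>.
\<close>

lemma norm_correction:
  assumes k: "k \<in> S"
  shows "5 * \<Lambda> * norm (correction k) \<le> 6 * norm (E (u k))"
proof -
  let ?z = "correction k"
  have "\<Lambda> * norm (U.proj (I - N) ?z) \<le> norm (U.proj (I - N) (E (u k + ?z)))"
  proof (rule U.norm_proj_scale)
    fix l assume l: "l \<in> I - N"
    show "\<Lambda> * \<bar>u l \<bullet> ?z\<bar> \<le> \<bar>u l \<bullet> E (u k + ?z)\<bar>"
      using far[OF k l] correction_far[OF k l] by (metis abs_ge_zero abs_mult mult_right_mono)
  qed (use \<Lambda>_pos in auto)
  also have "\<dots> \<le> norm (E (u k)) + norm (E ?z)"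
    using U.norm_proj_le[OF M_I] norm_triangle_ineq order_trans
    by (metis linear_add[OF linear_E])
  also have "\<dots> \<le> norm (E (u k)) + e * norm ?z" using E_bound by simp
  finally have "\<Lambda> * norm ?z \<le> norm (E (u k)) + e * norm ?z"
    using norm_far_part[OF correction_near[OF k]] by simp
  moreover have "6 * e * norm ?z \<le> \<Lambda> * norm ?z"
    using e_small by (intro mult_right_mono) auto
  ultimately show ?thesis by linarith
qed

lemma norm_E_basis: "i \<in> I \<Longrightarrow> norm (E (u i)) \<le> e"
  using E_bound[of "u i"] U.inner_basis[of i i] by (simp add: norm_eq_sqrt_inner)

text \<open>
  Only the part \<open>u k \<bullet> E (correction k)\<close> of the diagonal entry is split off: the other part,
  \<open>u k \<bullet> E (u k)\<close>, is at most \<open>x\<close>.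
\<close>

definition offdiag :: "'i \<Rightarrow> 'a" where
  "offdiag k = U.proj N (E (u k + correction k)) - (u k \<bullet> E (correction k)) *\<^sub>R u k"

text \<open>
  Let \<open>z0\<close> be the correction to first order, obtained by replacing \<open>E (u k + z)\<close> by \<open>E (u k)\<close>
  in the equation for \<open>z = correction k\<close>. The entries of the residual coming from \<open>u k + z0\<close> are at most
  \<open>x + y\<close> once \<open>u k \<bullet> E z0\<close> has been taken off the diagonal one. The error \<open>correction k - z0\<close> is
  smaller than the correction by a factor \<open>e / \<Lambda>\<close>, and the \<open>N\<close>-part of its image under \<open>E\<close> has
  norm of order \<open>sqrt (card N) * w\<^sup>2\<close> times \<open>e / \<Lambda>\<^sup>2\<close>, which the hypothesis on \<open>w\<close> turns into a multiple of
  \<open>\<delta> * (e / \<Lambda>)\<close>.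
\<close>

lemma norm_offdiag:
  assumes k: "k \<in> S"
  shows "norm (offdiag k) \<le> sqrt (card N) * (x + y) + \<delta> / 120 * (e / \<Lambda>)"
proof -
  let ?z = "correction k"
  define z0 where "z0 = (\<Sum>l\<in>I - N. ((u l \<bullet> E (u k)) / (ev k - ev l)) *\<^sub>R u l)"
  have kI: "k \<in> I" "k \<in> N" using k index_sets by auto
  have z0N: "u j \<bullet> (?z - z0) = 0" if "j \<in> N" for j
    using that index_sets correction_near[OF k that] U.inner_combination[OF M_I, of j]
    by (auto simp: z0_def inner_diff_right)
  have z0M: "(ev k - ev l) * (u l \<bullet> (?z - z0)) = u l \<bullet> E ?z" if l: "l \<in> I - N" for l
  proof -
    have "ev k - ev l \<noteq> 0" using far[OF k l] \<Lambda>_pos by auto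
    moreover have "u l \<bullet> z0 = (u l \<bullet> E (u k)) / (ev k - ev l)"
      using l U.inner_combination[OF M_I, of l] by (auto simp: z0_def)
    ultimately show ?thesis
      using correction_far[OF k l]
      by (simp add: inner_diff_right right_diff_distrib linear_add[OF linear_E] inner_add_right)
  qed
  have "\<Lambda> * norm (U.proj (I - N) (?z - z0)) \<le> norm (U.proj (I - N) (E ?z))"
  proof (rule U.norm_proj_scale)
    fix l assume l: "l \<in> I - N"
    show "\<Lambda> * \<bar>u l \<bullet> (?z - z0)\<bar> \<le> \<bar>u l \<bullet> E ?z\<bar>"
      using far[OF k l] z0M[OF l] by (metis abs_ge_zero abs_mult mult_right_mono)
  qed (use \<Lambda>_pos in auto)
  also have "\<dots> \<le> e * norm ?z" using U.norm_proj_le[OF M_I] E_bound order_trans by blast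
  finally have D1: "\<Lambda> * norm (?z - z0) \<le> e * norm ?z"
    using norm_far_part[OF z0N] by simp
  have "5 * \<Lambda> * norm ?z \<le> 6 * w"
    using norm_correction[OF k] w_bound[OF kI(2)] by linarith
  then have D2: "norm ?z \<le> 6 / 5 * w / \<Lambda>" using \<Lambda>_pos by (simp add: field_simps)
  have "norm (?z - z0) \<le> e * norm ?z / \<Lambda>" using D1 \<Lambda>_pos by (simp add: field_simps)
  also have "\<dots> \<le> e * (6 / 5 * w / \<Lambda>) / \<Lambda>"
    using D2 e_nonneg \<Lambda>_pos by (intro divide_right_mono mult_left_mono) auto
  finally have D: "norm (?z - z0) \<le> e * (6 / 5 * w / \<Lambda>) / \<Lambda>" .
  have off: "offdiag k = U.proj (N - {k}) (E (u k + z0)) + (u k \<bullet> E (u k)) *\<^sub>R u k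
      + U.proj (N - {k}) (E (?z - z0))"
  proof (rule U.coordinates_eqI)
    fix j assume j: "j \<in> I"
    have sub: "N - {k} \<subseteq> I" using index_sets by auto
    show "u j \<bullet> offdiag k = u j \<bullet> (U.proj (N - {k}) (E (u k + z0)) + (u k \<bullet> E (u k)) *\<^sub>R u k
      + U.proj (N - {k}) (E (?z - z0)))"
      using j kI index_sets sub
      by (auto simp: offdiag_def inner_add_right inner_diff_right U.inner_proj U.inner_basis
          linear_add[OF linear_E] linear_diff[OF linear_E])
  qed
  have main: "norm (U.proj (N - {k}) (E (u k + z0)) + (u k \<bullet> E (u k)) *\<^sub>R u k)
      \<le> sqrt (card N) * (x + y)"
  proof -
    let ?h = "U.proj (N - {k}) (E (u k + z0)) + (u k \<bullet> E (u k)) *\<^sub>R u k"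
    have sub: "N - {k} \<subseteq> I" using index_sets by auto
    have co: "u j \<bullet> ?h = (if j = k then u k \<bullet> E (u k) else if j \<in> N then u j \<bullet> E (u k) + u j \<bullet> E z0 else 0)"
      if "j \<in> I" for j
      using that kI sub
      by (auto simp: inner_add_right U.inner_proj U.inner_basis linear_add[OF linear_E])
    have "?h = U.proj N ?h"
      by (rule U.coordinates_eqI) (use co kI index_sets in \<open>auto simp: U.inner_proj\<close>)
    then have "norm ?h = norm (U.proj N ?h)" by simp
    also have "\<dots> \<le> sqrt (card N) * (x + y)"
    proof (rule U.norm_proj_le_card)
      fix j assume j: "j \<in> N"
      show "\<bar>u j \<bullet> ?h\<bar> \<le> x + y"
      proof (cases "j = k")
        case True
        then show ?thesis using co[of k] kI x_bound[of k k] y_nonneg by auto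
      next
        case False
        have "\<bar>u j \<bullet> E (u k)\<bar> \<le> x" using x_bound j kI by auto
        moreover have "\<bar>u j \<bullet> E z0\<bar> \<le> y" unfolding z0_def using y_bound j k False by auto
        ultimately show ?thesis using co[of j] j False index_sets by auto
      qed
    qed (use index_sets x_nonneg y_nonneg in auto)
    finally show ?thesis .
  qed
  have "norm (U.proj (N - {k}) (E (?z - z0))) \<le> sqrt (card N) * w * norm (?z - z0)"
    by (rule E_proj_N) auto
  also have "\<dots> \<le> sqrt (card N) * w * (e * (6 / 5 * w / \<Lambda>) / \<Lambda>)"
    using D w_nonneg by (intro mult_left_mono) auto
  also have "\<dots> = (sqrt (card N) * w * w) * (6 / 5 * e / \<Lambda>\<^sup>2)"
    by (simp add: power2_eq_square mult_ac)
  also have "\<dots> \<le> (\<delta> * \<Lambda> / 144) * (6 / 5 * e / \<Lambda>\<^sup>2)"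
    using sqrt_N_w_w e_nonneg by (intro mult_right_mono) auto
  also have "\<dots> = \<delta> / 120 * (e / \<Lambda>)"
    using \<Lambda>_pos by (simp add: power2_eq_square field_simps)
  finally show ?thesis
    using main off norm_triangle_ineq order_trans by (smt (verit, best))
qed

text \<open>
  When \<open>x\<close> and \<open>y\<close> are the maxima themselves, this is the relative norm of \<open>E\<close> divided by \<open>\<delta>\<close>.
\<close>

definition rel_error :: real where
  "rel_error = sqrt (card N) * (x + y) / \<delta>"

lemma norm_offdiag_rel:
  "k \<in> S \<Longrightarrow> norm (offdiag k) \<le> \<delta> * (rel_error + 1 / 120 * (e / \<Lambda>))"
  using norm_offdiag[of k] gap unfolding rel_error_def distrib_left by simp

lemma rel_error_nonneg: "0 \<le> rel_error"
  using x_nonneg y_nonneg gap by (simp add: rel_error_def)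

lemma norm_correction_w:
  assumes "k \<in> S"
  shows "norm (correction k) \<le> 6 / 5 * (w / \<Lambda>)"
proof -
  have "k \<in> N" using assms index_sets by auto
  then have "5 * \<Lambda> * norm (correction k) \<le> 6 * w"
    using norm_correction[OF assms] w_bound[of k] by linarith
  then show ?thesis using \<Lambda>_pos by (simp add: field_simps)
qed

lemma norm_correction_e:
  assumes "k \<in> S"
  shows "norm (correction k) \<le> 6 / 5 * (e / \<Lambda>)"
proof -
  have "k \<in> I" using assms index_sets by auto
  then have "5 * \<Lambda> * norm (correction k) \<le> 6 * e"
    using norm_correction[OF assms] norm_E_basis[of k] by linarith
  then show ?thesis using \<Lambda>_pos by (simp add: field_simps)
qed

section \<open>Old eigenvectors tested against the new ones outside\<close>

text \<open>
  The inner product of \<open>u' i\<close> with the residual of \<open>u k + correction k\<close> is \<open>ev' i - ev k\<close> times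
  \<open>u' i \<bullet> (u k + correction k)\<close>, and the first factor is at least \<open>\<delta> / 2\<close> for \<open>i\<close> outside \<open>S'\<close>.
  The diagonal entry \<open>d\<close> contributes \<open>d\<close> times the quantity to be estimated, with
  \<open>\<bar>d\<bar> \<le> \<delta> / 120\<close>, so that it can be moved to the left-hand side. Removing the correction
  costs its norm, of order \<open>e / \<Lambda>\<close>.
\<close>

lemma old_vector_outside:
  assumes k: "k \<in> S"
  shows "norm (U'.proj (I' - S') (u k)) \<le> 21 / 10 * rel_error + 13 / 10 * (e / \<Lambda>)"
proof -
  let ?Q = "U'.proj (I' - S')" and ?z = "correction k"
  define d where "d = u k \<bullet> E ?z"
  have kN: "k \<in> N" using k index_sets by auto
  have "\<bar>d\<bar> \<le> norm (E (u k)) * norm ?z"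
    unfolding d_def sym_E[symmetric] by (rule Cauchy_Schwarz_ineq2)
  also have "\<dots> \<le> w * (6 / 5 * (w / \<Lambda>))"
    using w_bound[OF kN] norm_correction_w[OF k] w_nonneg by (intro mult_mono) auto
  also have "\<dots> \<le> \<delta> / 120"
  proof -
    have "w\<^sup>2 \<le> card N * w\<^sup>2" using card_N by (simp add: mult_le_cancel_right1)
    then have "144 * w\<^sup>2 \<le> \<delta> * \<Lambda>" using w_small by linarith
    then show ?thesis using \<Lambda>_pos by (simp add: field_simps power2_eq_square)
  qed
  finally have d: "\<bar>d\<bar> \<le> \<delta> / 120" .
  have split: "U.proj N (E (u k + ?z)) = offdiag k + d *\<^sub>R u k"
    by (simp add: offdiag_def d_def)
  have "\<delta> / 2 * norm (?Q (u k + ?z)) \<le> norm (?Q (offdiag k + d *\<^sub>R u k))"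
  proof (rule U'.norm_proj_scale)
    fix i assume i: "i \<in> I' - S'"
    have "(ev' i - ev k) * (u' i \<bullet> (u k + ?z)) = u' i \<bullet> (offdiag k + d *\<^sub>R u k)"
      using inner_A'[of i "u k + ?z"] i unfolding split[symmetric] residual[OF k, symmetric]
      by (simp only: inner_diff_right inner_scaleR_right left_diff_distrib) auto
    then show "\<delta> / 2 * \<bar>u' i \<bullet> (u k + ?z)\<bar> \<le> \<bar>u' i \<bullet> (offdiag k + d *\<^sub>R u k)\<bar>"
      using sep_out[OF i k] by (metis abs_ge_zero abs_mult mult_right_mono)
  qed (use gap in auto)
  also have "?Q (offdiag k + d *\<^sub>R u k) = ?Q (offdiag k) + d *\<^sub>R ?Q (u k)"
    by (simp add: U'.proj_add linear_cmul[OF U'.linear_proj])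
  also have "norm \<dots> \<le> norm (?Q (offdiag k)) + \<bar>d\<bar> * norm (?Q (u k))"
    by (rule order_trans[OF norm_triangle_ineq]) simp
  also have "\<dots> \<le> norm (offdiag k) + \<delta> / 120 * norm (?Q (u k))"
    using d by (intro add_mono U'.norm_proj_le mult_right_mono) auto
  finally have 1: "\<delta> / 2 * norm (?Q (u k + ?z)) \<le> norm (offdiag k) + \<delta> / 120 * norm (?Q (u k))" .
  have "norm (?Q (u k)) = norm (?Q (u k + ?z) - ?Q ?z)" by (simp add: U'.proj_add)
  also have "\<dots> \<le> norm (?Q (u k + ?z)) + norm ?z"
    using norm_triangle_ineq4[of "?Q (u k + ?z)" "?Q ?z"] U'.norm_proj_le[of "I' - S'" ?z] by auto
  finally have "norm (?Q (u k)) \<le> norm (?Q (u k + ?z)) + 6 / 5 * (e / \<Lambda>)"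
    using norm_correction_e[OF k] by linarith
  then have "\<delta> / 2 * norm (?Q (u k)) \<le> \<delta> / 2 * (norm (?Q (u k + ?z)) + 6 / 5 * (e / \<Lambda>))"
    using gap by (intro mult_left_mono) auto
  also have "\<dots> = \<delta> / 2 * norm (?Q (u k + ?z)) + \<delta> * (3 / 5 * (e / \<Lambda>))" by (simp add: distrib_left)
  also have "\<dots> \<le> \<delta> * (rel_error + 1 / 120 * (e / \<Lambda>)) + \<delta> / 120 * norm (?Q (u k)) + \<delta> * (3 / 5 * (e / \<Lambda>))"
    using 1 norm_offdiag_rel[OF k] by linarith
  finally have "\<delta> * (59 / 120 * norm (?Q (u k))) \<le> \<delta> * (rel_error + 73 / 120 * (e / \<Lambda>))"
    by (simp only: distrib_left)
  then have "59 / 120 * norm (?Q (u k)) \<le> rel_error + 73 / 120 * (e / \<Lambda>)" using gap by simp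
  moreover have "0 \<le> e / \<Lambda>" using e_nonneg \<Lambda>_pos by simp
  ultimately show ?thesis using rel_error_nonneg by linarith
qed

section \<open>New eigenvectors expanded in the corrected old ones\<close>

lemma corrected_expansion:
  "v = (\<Sum>k\<in>S. (u k \<bullet> v) *\<^sub>R (u k + correction k)) + U.proj (N - S) v
     + (U.proj (I - N) v - (\<Sum>k\<in>S. (u k \<bullet> v) *\<^sub>R correction k))"
  using U.proj_split_full[OF index_sets(2), of v] U.proj_split[OF index_sets(1,2), of v]
  by (simp add: U.proj_def scaleR_add_right sum.distrib)

lemma E_expansion:
  defines "m' v \<equiv> U.proj (I - N) v - (\<Sum>k\<in>S. (u k \<bullet> v) *\<^sub>R correction k)"
  shows "E v = (\<Sum>k\<in>S. (u k \<bullet> v) *\<^sub>R E (u k + correction k)) + E (U.proj (N - S) v) + E (m' v)"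
proof -
  have "E v = E ((\<Sum>k\<in>S. (u k \<bullet> v) *\<^sub>R (u k + correction k)) + U.proj (N - S) v + m' v)"
    unfolding m'_def using corrected_expansion[of v] by simp
  then show ?thesis
    by (simp only: linear_add[OF linear_E] linear_sum[OF linear_E] linear_cmul[OF linear_E])
qed

text \<open>
  The component in \<open>I - N\<close> of the eigenvalue equation for \<open>u' i\<close>. The equation defining the
  corrections removes the direct coupling from \<open>S\<close> to \<open>I - N\<close>. What remains of the \<open>S\<close>-part comes
  from replacing \<open>ev k\<close> by \<open>ev' i\<close>, and \<open>(ev' i - ev k) * (u k \<bullet> u' i) = u k \<bullet> E (u' i)\<close> shows
  that it is one order smaller. The term \<open>E m'\<close> is absorbed with \<open>e \<le> \<Lambda> / 6\<close>, which turns
  \<open>\<Lambda> / 2\<close> into \<open>\<Lambda> / 3\<close>.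
\<close>

lemma new_vector_far:
  assumes i: "i \<in> S'"
  defines "m' \<equiv> U.proj (I - N) (u' i) - (\<Sum>k\<in>S. (u k \<bullet> u' i) *\<^sub>R correction k)"
  shows "\<Lambda> / 3 * norm m' \<le> sqrt (card N) * w * norm (U.proj (N - S) (u' i))
     + norm (\<Sum>k\<in>S. (u k \<bullet> E (u' i)) *\<^sub>R correction k)"
proof -
  define g where "g = U.proj (N - S) (u' i)"
  define \<psi> where "\<psi> = (\<Sum>k\<in>S. (u k \<bullet> E (u' i)) *\<^sub>R correction k)"
  have iI: "i \<in> I'" using i index_sets by auto
  have kI: "k \<in> I" if "k \<in> S" for k using that index_sets by auto
  have m'N: "u j \<bullet> m' = 0" if "j \<in> N" for j
    using that index_sets correction_near by (auto simp: m'_def inner_diff_right inner_sum_right U.inner_proj)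
  have "\<Lambda> / 2 * norm (U.proj (I - N) m') \<le> norm (U.proj (I - N) (E g + E m' - \<psi>))"
  proof (rule U.norm_proj_scale)
    fix l assume l: "l \<in> I - N"
    have "u l \<bullet> (\<Sum>k\<in>S. (u k \<bullet> u' i) *\<^sub>R E (u k + correction k))
        = (\<Sum>k\<in>S. (u k \<bullet> u' i) * ((ev k - ev l) * (u l \<bullet> correction k)))"
      using l by (simp add: inner_sum_right correction_far)
    also have "\<dots> = (\<Sum>k\<in>S. (ev' i - ev l) * ((u k \<bullet> u' i) * (u l \<bullet> correction k))
        - (u k \<bullet> E (u' i)) * (u l \<bullet> correction k))"
      by (rule sum.cong) (auto simp: eigen'_coordinates[OF iI kI, symmetric] algebra_simps)
    also have "\<dots> = (ev' i - ev l) * (u l \<bullet> (\<Sum>k\<in>S. (u k \<bullet> u' i) *\<^sub>R correction k)) - u l \<bullet> \<psi>"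
      by (simp add: \<psi>_def sum_subtractf inner_sum_right sum_distrib_left)
    finally have *: "u l \<bullet> (\<Sum>k\<in>S. (u k \<bullet> u' i) *\<^sub>R E (u k + correction k)) = \<dots>" .
    have "u l \<bullet> U.proj (I - N) (u' i) = u l \<bullet> u' i" using l by (simp add: U.inner_proj M_I)
    then have "(ev' i - ev l) * (u l \<bullet> m') = u l \<bullet> (E g + E m' - \<psi>)"
      using eigen'_coordinates[OF iI, of l] l * E_expansion[of "u' i", folded m'_def g_def]
      by (simp add: m'_def inner_diff_right inner_add_right right_diff_distrib)
    then show "\<Lambda> / 2 * \<bar>u l \<bullet> m'\<bar> \<le> \<bar>u l \<bullet> (E g + E m' - \<psi>)\<bar>"
      using sep_far[OF i l] by (metis abs_ge_zero abs_mult mult_right_mono)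
  qed (use \<Lambda>_pos in auto)
  also have "\<dots> \<le> norm (E g + E m' - \<psi>)" by (rule U.norm_proj_le[OF M_I])
  also have "\<dots> \<le> norm (E g) + norm (E m') + norm \<psi>" by norm
  also have "\<dots> \<le> sqrt (card N) * w * norm g + e * norm m' + norm \<psi>"
    using E_of_N_part[of "N - S" "u' i"] E_bound[of m'] by (simp add: g_def)
  finally have "\<Lambda> / 2 * norm m' \<le> sqrt (card N) * w * norm g + e * norm m' + norm \<psi>"
    using norm_far_part[OF m'N] by simp
  moreover have "e * norm m' \<le> \<Lambda> / 6 * norm m'" using e_small by (intro mult_right_mono) auto
  ultimately show ?thesis unfolding g_def \<psi>_def by (simp add: field_simps)
qed

text \<open>
  The component in \<open>N - S\<close> of the eigenvalue equation for \<open>u' i\<close>. Indices there differ from all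
  \<open>k \<in> S\<close>, so the residuals of the corrected vectors enter only through their off-diagonal parts.
  The block of \<open>E\<close> on \<open>N - S\<close> is absorbed, which turns \<open>\<delta> / 2\<close> into \<open>5 * \<delta> / 12\<close>.
\<close>

lemma new_vector_near:
  assumes i: "i \<in> S'"
  defines "m' \<equiv> U.proj (I - N) (u' i) - (\<Sum>k\<in>S. (u k \<bullet> u' i) *\<^sub>R correction k)"
  shows "5 / 12 * \<delta> * norm (U.proj (N - S) (u' i))
     \<le> norm (\<Sum>k\<in>S. (u k \<bullet> u' i) *\<^sub>R offdiag k) + sqrt (card N) * w * norm m'"
proof -
  define g where "g = U.proj (N - S) (u' i)"
  define \<phi> where "\<phi> = (\<Sum>k\<in>S. (u k \<bullet> u' i) *\<^sub>R offdiag k)"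
  let ?P = "U.proj (N - S)"
  have iI: "i \<in> I'" using i index_sets by auto
  have "\<delta> / 2 * norm (?P (u' i)) \<le> norm (?P (\<phi> + E g + E m'))"
  proof (rule U.norm_proj_scale)
    fix j assume j: "j \<in> N - S"
    then have jI: "j \<in> I" "j \<in> I - S" using index_sets by auto
    have "u j \<bullet> offdiag k = u j \<bullet> E (u k + correction k)" if "k \<in> S" for k
      using that j jI index_sets by (auto simp: offdiag_def inner_diff_right U.inner_proj U.inner_basis subset_iff)
    then have "u j \<bullet> \<phi> = u j \<bullet> (\<Sum>k\<in>S. (u k \<bullet> u' i) *\<^sub>R E (u k + correction k))"
      by (simp add: \<phi>_def inner_sum_right)
    then have "(ev' i - ev j) * (u j \<bullet> u' i) = u j \<bullet> (\<phi> + E g + E m')"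
      using eigen'_coordinates[OF iI jI(1)] E_expansion[of "u' i", folded m'_def g_def]
      by (simp add: inner_add_right)
    then show "\<delta> / 2 * \<bar>u j \<bullet> u' i\<bar> \<le> \<bar>u j \<bullet> (\<phi> + E g + E m')\<bar>"
      using sep_in[OF i jI(2)] by (metis abs_ge_zero abs_mult mult_right_mono)
  qed (use gap N_diff_S in auto)
  also have "\<dots> \<le> norm (?P \<phi>) + norm (?P (E g)) + norm (?P (E m'))"
    unfolding U.proj_add by norm
  also have "\<dots> \<le> norm \<phi> + \<delta> / 12 * norm g + sqrt (card N) * w * norm m'"
    using U.norm_proj_le[OF N_diff_S, of \<phi>] E_block_N[of "N - S" "u' i"] E_proj_N[of "N - S" m']
    by (simp add: g_def)
  finally show ?thesis unfolding g_def \<phi>_def by (simp add: algebra_simps)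
qed

text \<open>
  The two coupled inequalities are solved for the unknown norms \<open>g\<close> and \<open>m\<close>: inserting the bound
  for \<open>m\<close> into the inequality for \<open>g\<close> produces \<open>3 * c\<^sup>2 / \<Lambda> \<le> \<delta> / 48\<close> in front of \<open>g\<close>. The
  right-hand side is kept as a combination of norms that depend linearly on \<open>u' i\<close>, ready for
  \<open>hilbert_schmidt_bound\<close>.
\<close>

lemma new_vector_outside:
  assumes i: "i \<in> S'"
  defines "c \<equiv> sqrt (card N) * w"
  shows "norm (U.proj (I - S) (u' i))
     \<le> 16 / 5 / \<delta> * norm (\<Sum>k\<in>S. (u k \<bullet> u' i) *\<^sub>R offdiag k)
       + (48 / 5 * c / (\<delta> * \<Lambda>) + 3 / \<Lambda>) * norm (\<Sum>k\<in>S. (u k \<bullet> E (u' i)) *\<^sub>R correction k)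
       + norm (\<Sum>k\<in>S. (u k \<bullet> u' i) *\<^sub>R correction k)"
proof -
  define \<theta> where "\<theta> = (\<Sum>k\<in>S. (u k \<bullet> u' i) *\<^sub>R correction k)"
  define \<Phi> where "\<Phi> = norm (\<Sum>k\<in>S. (u k \<bullet> u' i) *\<^sub>R offdiag k)"
  define \<Psi> where "\<Psi> = norm (\<Sum>k\<in>S. (u k \<bullet> E (u' i)) *\<^sub>R correction k)"
  define g where "g = norm (U.proj (N - S) (u' i))"
  define m where "m = norm (U.proj (I - N) (u' i) - \<theta>)"
  have c0: "0 \<le> c" using w_nonneg by (simp add: c_def)
  have c1: "12 * c \<le> \<Lambda>" using sqrt_N_w by (simp add: c_def)
  have c2: "144 * (c * c) \<le> \<delta> * \<Lambda>"
    using w_small by (simp add: c_def power2_eq_square algebra_simps)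
  have g0: "0 \<le> g" and \<Phi>0: "0 \<le> \<Phi>" and \<Psi>0: "0 \<le> \<Psi>"
    by (simp_all add: g_def \<Phi>_def \<Psi>_def)
  have "\<Lambda> / 3 * m \<le> c * g + \<Psi>"
    using new_vector_far[OF i] by (simp add: m_def g_def \<Psi>_def c_def \<theta>_def)
  then have m: "m \<le> 3 / \<Lambda> * (c * g + \<Psi>)" using \<Lambda>_pos by (simp add: field_simps)
  have "5 / 12 * \<delta> * g \<le> \<Phi> + c * m"
    using new_vector_near[OF i] by (simp add: m_def g_def \<Phi>_def c_def \<theta>_def)
  also have "c * m \<le> c * (3 / \<Lambda> * (c * g + \<Psi>))" using m c0 by (rule mult_left_mono)
  also have "\<dots> = 3 * (c * c) / \<Lambda> * g + 3 * c / \<Lambda> * \<Psi>"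
    by (simp add: distrib_left add_divide_distrib mult_ac)
  also have "3 * (c * c) / \<Lambda> * g \<le> \<delta> / 48 * g"
    using c2 \<Lambda>_pos by (intro mult_right_mono g0) (simp add: field_simps)
  finally have "5 / 12 * \<delta> * g \<le> \<Phi> + (\<delta> / 48 * g + 3 * c / \<Lambda> * \<Psi>)" by simp
  then have "19 / 48 * (\<delta> * g) \<le> \<Phi> + 3 * c / \<Lambda> * \<Psi>" by simp
  moreover have "0 \<le> \<Phi> + 3 * c / \<Lambda> * \<Psi>" using c0 \<Lambda>_pos \<Psi>0 \<Phi>0 by simp
  ultimately have "5 / 4 * (\<delta> * g) \<le> 16 / 5 * (\<Phi> + 3 * c / \<Lambda> * \<Psi>)" by argo
  then have g: "5 / 4 * g \<le> 16 / 5 * (\<Phi> + 3 * c / \<Lambda> * \<Psi>) / \<delta>"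
    using gap by (simp add: field_simps)
  have "c / \<Lambda> \<le> 1 / 12" unfolding pos_divide_le_eq[OF \<Lambda>_pos] using c1 by linarith
  then have "3 * (c / \<Lambda>) \<le> 1 / 4" by linarith
  then have "3 * (c / \<Lambda>) * g \<le> 1 / 4 * g" by (rule mult_right_mono) (rule g0)
  moreover have "3 / \<Lambda> * (c * g + \<Psi>) = 3 * (c / \<Lambda>) * g + 3 / \<Lambda> * \<Psi>"
    by (simp add: distrib_left)
  ultimately have m': "m \<le> 1 / 4 * g + 3 / \<Lambda> * \<Psi>" using m by linarith
  have split: "U.proj (I - S) (u' i) = U.proj (N - S) (u' i) + U.proj (I - N) (u' i)"
  proof -
    have "(I - S) - (N - S) = I - N" using index_sets by blast
    then show ?thesis using U.proj_split[of "N - S" "I - S" "u' i"] index_sets by auto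
  qed
  have "norm (U.proj (I - S) (u' i)) \<le> g + m + norm \<theta>"
    unfolding split g_def m_def by norm
  also have "\<dots> \<le> 5 / 4 * g + 3 / \<Lambda> * \<Psi> + norm \<theta>" using m' by simp
  also have "\<dots> \<le> 16 / 5 * (\<Phi> + 3 * c / \<Lambda> * \<Psi>) / \<delta> + 3 / \<Lambda> * \<Psi> + norm \<theta>" using g by simp
  also have "\<dots> = 16 / 5 / \<delta> * \<Phi> + (48 / 5 * c / (\<delta> * \<Lambda>) + 3 / \<Lambda>) * \<Psi> + norm \<theta>"
    using gap \<Lambda>_pos by (simp add: field_simps)
  finally show ?thesis unfolding \<theta>_def \<Phi>_def \<Psi>_def .
qed

text \<open>
  A bound for each single \<open>u' i\<close> would give a factor \<open>sqrt (card S')\<close>; the Hilbert-Schmidt bound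
  replaces it by \<open>sqrt (card S)\<close>.
\<close>

lemma new_vectors_outside:
  "L2_set (\<lambda>i. norm (U.proj (I - S) (u' i))) S'
     \<le> sqrt (card S) * (16 / 5 * rel_error + 2 * (e / \<Lambda>))"
proof -
  define c where "c = sqrt (card N) * w"
  define \<theta> where "\<theta> i = norm (\<Sum>k\<in>S. (u k \<bullet> u' i) *\<^sub>R correction k)" for i
  define \<Phi> where "\<Phi> i = norm (\<Sum>k\<in>S. (u k \<bullet> u' i) *\<^sub>R offdiag k)" for i
  define \<Psi> where "\<Psi> i = norm (\<Sum>k\<in>S. (u k \<bullet> E (u' i)) *\<^sub>R correction k)" for i
  define a where "a = 48 / 5 * c / (\<delta> * \<Lambda>) + 3 / \<Lambda>"
  have \<epsilon>0: "0 \<le> e / \<Lambda>" using e_nonneg \<Lambda>_pos by simp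
  have c0: "0 \<le> c" using w_nonneg by (simp add: c_def)
  have a0: "0 \<le> a" using c0 gap \<Lambda>_pos by (simp add: a_def)
  note hs = hilbert_schmidt_bound[OF U.orthonormal_basis_axioms U'.orthonormal_basis_axioms
      S_I index_sets(3)]
  note hs_id = hs[of "\<lambda>v. v" 1, simplified, OF linear_id[unfolded id_def]]
  have \<Phi>: "L2_set \<Phi> S' \<le> sqrt (card S) * (\<delta> * (rel_error + 1 / 120 * (e / \<Lambda>)))"
    unfolding \<Phi>_def using gap rel_error_nonneg \<epsilon>0
    by (intro order_trans[OF hs_id] L2_set_const_bound norm_offdiag_rel) auto
  have \<theta>: "L2_set \<theta> S' \<le> sqrt (card S) * (6 / 5 * (e / \<Lambda>))"
    unfolding \<theta>_def using \<epsilon>0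
    by (intro order_trans[OF hs_id] L2_set_const_bound norm_correction_e) auto
  have "L2_set \<Psi> S' \<le> e * L2_set (\<lambda>k. norm (correction k)) S"
    unfolding \<Psi>_def by (rule hs[OF linear_E sym_E E_bound e_nonneg])
  also have "\<dots> \<le> e * (sqrt (card S) * (6 / 5 * (w / \<Lambda>)))"
    using w_nonneg \<Lambda>_pos
    by (intro mult_left_mono L2_set_const_bound norm_correction_w e_nonneg) auto
  finally have \<Psi>: "L2_set \<Psi> S' \<le> e * (sqrt (card S) * (6 / 5 * (w / \<Lambda>)))" .
  have "a * w \<le> 2 / 5"
  proof -
    have "48 / 5 * c / (\<delta> * \<Lambda>) * w = 48 / 5 * (c * w) / (\<delta> * \<Lambda>)" by simp
    also have "\<dots> \<le> 1 / 15"
      using sqrt_N_w_w gap \<Lambda>_pos by (simp add: c_def divide_le_eq mult_ac)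
    finally have 1: "48 / 5 * c / (\<delta> * \<Lambda>) * w \<le> 1 / 15" .
    have "1 \<le> sqrt (card N)" using card_N by simp
    then have "w \<le> sqrt (card N) * w" using w_nonneg by (simp add: mult_le_cancel_right1)
    then have "12 * w \<le> \<Lambda>" using sqrt_N_w by linarith
    then have "3 / \<Lambda> * w \<le> 1 / 4" using \<Lambda>_pos by (simp add: field_simps)
    with 1 show ?thesis by (simp add: a_def distrib_right)
  qed
  then have aw: "a * w * (6 / 5 * (sqrt (card S) * (e / \<Lambda>))) \<le> 2 / 5 * (6 / 5 * (sqrt (card S) * (e / \<Lambda>)))"
    using \<epsilon>0 by (intro mult_right_mono mult_nonneg_nonneg) auto
  have "L2_set (\<lambda>i. norm (U.proj (I - S) (u' i))) S'
      \<le> L2_set (\<lambda>i. 16 / 5 / \<delta> * \<Phi> i + a * \<Psi> i + \<theta> i) S'"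
    unfolding \<theta>_def \<Phi>_def \<Psi>_def a_def c_def
    by (intro L2_set_mono new_vector_outside) auto
  also have "\<dots> \<le> L2_set (\<lambda>i. 16 / 5 / \<delta> * \<Phi> i) S' + L2_set (\<lambda>i. a * \<Psi> i) S' + L2_set \<theta> S'"
    by (intro order_trans[OF L2_set_triangle_ineq] add_mono order_refl)
  also have "\<dots> = 16 / 5 / \<delta> * L2_set \<Phi> S' + a * L2_set \<Psi> S' + L2_set \<theta> S'"
    using gap a0
    by (subst (1 2) L2_set_right_distrib) auto
  also have "\<dots> \<le> 16 / 5 / \<delta> * (sqrt (card S) * (\<delta> * (rel_error + 1 / 120 * (e / \<Lambda>))))
      + a * (e * (sqrt (card S) * (6 / 5 * (w / \<Lambda>)))) + sqrt (card S) * (6 / 5 * (e / \<Lambda>))"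
    using \<Phi> \<Psi> \<theta> gap a0 by (intro add_mono mult_left_mono) auto
  also have "\<dots> = sqrt (card S) * (16 / 5 * rel_error + (16 / 5 / 120 + 6 / 5) * (e / \<Lambda>))
      + a * w * (6 / 5 * (sqrt (card S) * (e / \<Lambda>)))"
    using gap by (simp add: field_simps)
  also have "\<dots> \<le> sqrt (card S) * (16 / 5 * rel_error + (16 / 5 / 120 + 6 / 5) * (e / \<Lambda>))
      + sqrt (card S) * (12 / 25 * (e / \<Lambda>))"
    using aw by simp
  also have "\<dots> = sqrt (card S) * (16 / 5 * rel_error + (16 / 5 / 120 + 6 / 5 + 12 / 25) * (e / \<Lambda>))"
    by (simp only: distrib_left distrib_right add.assoc)
  also have "\<dots> \<le> sqrt (card S) * (16 / 5 * rel_error + 2 * (e / \<Lambda>))"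
    using \<epsilon>0 by (intro mult_left_mono add_mono mult_right_mono) auto
  finally show ?thesis .
qed

text \<open>
  Of the two terms of \<open>P' - P = (1 - P) P' - P (1 - P')\<close>, the first is estimated by
  \<open>new_vectors_outside\<close> and the Cauchy-Schwarz inequality, the second through its adjoint
  \<open>(1 - P') P\<close> by \<open>old_vector_outside\<close>.
\<close>

lemma proj_diff_bound:
  "norm (U'.proj S' v - U.proj S v) \<le> 6 * sqrt (card S) * (rel_error + e / \<Lambda>) * norm v"
proof -
  let ?Q' = "U'.proj (I' - S')"
  have \<epsilon>0: "0 \<le> e / \<Lambda>" using e_nonneg \<Lambda>_pos by simp
  have v: "v = U'.proj S' v + ?Q' v" by (rule U'.proj_split_full[OF index_sets(3)])
  have "U'.proj S' v - U.proj S v = U.proj (I - S) (U'.proj S' v) - U.proj S (?Q' v)"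
    using U.proj_split_full[OF S_I, of "U'.proj S' v"] arg_cong[OF v, of "U.proj S"]
    by (simp add: U.proj_add algebra_simps)
  then have "norm (U'.proj S' v - U.proj S v)
      \<le> norm (U.proj (I - S) (U'.proj S' v)) + norm (U.proj S (?Q' v))"
    using norm_triangle_ineq4 by metis
  also have "norm (U.proj (I - S) (U'.proj S' v))
      \<le> sqrt (card S) * (16 / 5 * rel_error + 2 * (e / \<Lambda>)) * norm v"
  proof -
    let ?f = "\<lambda>i. norm (U.proj (I - S) (u' i))"
    have "U.proj (I - S) (U'.proj S' v) = (\<Sum>i\<in>S'. (u' i \<bullet> v) *\<^sub>R U.proj (I - S) (u' i))"
      by (simp add: U'.proj_def linear_sum[OF U.linear_proj] linear_cmul[OF U.linear_proj])
    also have "norm \<dots> \<le> (\<Sum>i\<in>S'. \<bar>u' i \<bullet> v\<bar> * \<bar>?f i\<bar>)"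
      by (rule order_trans[OF norm_sum]) simp
    also have "\<dots> \<le> L2_set (\<lambda>i. u' i \<bullet> v) S' * L2_set ?f S'" by (rule L2_set_mult_ineq)
    also have "\<dots> \<le> norm v * L2_set ?f S'"
      using U'.norm_proj_le[OF index_sets(3), of v]
      by (intro mult_right_mono) (auto simp: U'.norm_proj[OF index_sets(3)])
    also have "\<dots> \<le> norm v * (sqrt (card S) * (16 / 5 * rel_error + 2 * (e / \<Lambda>)))"
      by (intro mult_left_mono new_vectors_outside) auto
    finally show ?thesis by (simp add: mult.commute)
  qed
  also have "norm (U.proj S (?Q' v)) \<le> sqrt (card S) * ((21 / 10 * rel_error + 13 / 10 * (e / \<Lambda>)) * norm v)"
  proof (rule U.norm_proj_le_card[OF S_I])
    fix k assume k: "k \<in> S"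
    have "\<bar>u k \<bullet> ?Q' v\<bar> \<le> norm (?Q' (u k)) * norm v"
      unfolding U'.proj_self_adjoint[symmetric] by (rule Cauchy_Schwarz_ineq2)
    also have "\<dots> \<le> (21 / 10 * rel_error + 13 / 10 * (e / \<Lambda>)) * norm v"
      by (intro mult_right_mono old_vector_outside k) auto
    finally show "\<bar>u k \<bullet> ?Q' v\<bar> \<le> (21 / 10 * rel_error + 13 / 10 * (e / \<Lambda>)) * norm v" .
  qed (use rel_error_nonneg \<epsilon>0 in auto)
  also have "sqrt (card S) * (16 / 5 * rel_error + 2 * (e / \<Lambda>)) * norm v
      + sqrt (card S) * ((21 / 10 * rel_error + 13 / 10 * (e / \<Lambda>)) * norm v)
      = sqrt (card S) * (53 / 10 * rel_error + 33 / 10 * (e / \<Lambda>)) * norm v"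
    by (simp add: algebra_simps)
  also have "\<dots> \<le> sqrt (card S) * (6 * (rel_error + e / \<Lambda>)) * norm v"
    using rel_error_nonneg \<epsilon>0 by (intro mult_left_mono mult_right_mono) auto
  finally show ?thesis by (simp add: mult_ac)
qed

end

section \<open>Matrices, maxima and the contour\<close>

lemma orthonormal_basis_of_eigenbasis:
  fixes u :: "nat \<Rightarrow> real^'n"
  assumes "ordered_eigenbasis M ev u"
  shows "orthonormal_basis {1..CARD('n)} u"
proof
  let ?I = "{1..CARD('n)}"
  show orth: "u i \<bullet> u j = (if i = j then 1 else 0)" if "i \<in> ?I" "j \<in> ?I" for i j
    using assms that unfolding ordered_eigenbasis_def by blast
  have inj: "inj_on u ?I"
    by (rule inj_onI) (metis orth zero_neq_one)
  have "pairwise orthogonal (u ` ?I)"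
    unfolding pairwise_def orthogonal_def using orth by fastforce
  moreover have "0 \<notin> u ` ?I"
    using orth by (metis imageE inner_zero_left zero_neq_one)
  ultimately have "independent (u ` ?I)" by (rule pairwise_orthogonal_independent)
  moreover have "card (u ` ?I) = dim (UNIV :: (real^'n) set)"
    using inj by (simp add: card_image)
  ultimately have span: "UNIV \<subseteq> span (u ` ?I)"
    using card_eq_dim[of "u ` ?I" UNIV] by auto
  fix v :: "real^'n"
  define d where "d = v - (\<Sum>i\<in>?I. (u i \<bullet> v) *\<^sub>R u i)"
  have "orthogonal d y" if "y \<in> u ` ?I" for y
  proof -
    obtain j where j: "j \<in> ?I" "y = u j" using \<open>y \<in> u ` ?I\<close> by blast
    have "(\<Sum>i\<in>?I. (u i \<bullet> v) * (u i \<bullet> u j)) = (\<Sum>i\<in>?I. if i = j then u i \<bullet> v else 0)"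
      using j by (intro sum.cong) (auto simp: orth)
    then have "d \<bullet> u j = 0"
      using j by (simp add: d_def inner_diff_left inner_sum_left inner_commute[of v])
    then show ?thesis by (simp add: orthogonal_def j)
  qed
  then have "orthogonal d d" using span orthogonal_to_span[of d "u ` ?I" d] by blast
  then show "(\<Sum>i\<in>?I. (u i \<bullet> v) *\<^sub>R u i) = v" by (simp add: orthogonal_self d_def)
qed simp

lemma outer_product_mult: "outer_product a b *v v = (b \<bullet> v) *\<^sub>R a"
  by (simp add: vec_eq_iff outer_product_def matrix_vector_mult_def inner_vec_def
      sum_distrib_left mult_ac)

lemma sum_matrix_vector_mult:
  fixes f :: "'i \<Rightarrow> real^'n^'n"
  shows "(\<Sum>i\<in>S. f i) *v v = (\<Sum>i\<in>S. f i *v v)"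
  by (induction S rule: infinite_finite_induct) (simp_all add: matrix_vector_mult_add_rdistrib)

lemma spectral_projection_mult:
  "spectral_projection u S *v v = (\<Sum>i\<in>S. (u i \<bullet> v) *\<^sub>R u i)"
  by (simp add: spectral_projection_def sum_matrix_vector_mult outer_product_mult)

lemma Max0_upper: "finite X \<Longrightarrow> a \<in> X \<Longrightarrow> a \<le> Max0 X"
  by (auto simp: Max0_def)

lemma Max0_nonneg: "finite X \<Longrightarrow> (\<And>a. a \<in> X \<Longrightarrow> 0 \<le> a) \<Longrightarrow> 0 \<le> Max0 X"
  by (auto simp: Max0_def)

lemma x_param_upper:
  assumes "finite N" "i \<in> N" "j \<in> N"
  shows "\<bar>u i \<bullet> (E *v u j)\<bar> \<le> x_param E u N"
  unfolding x_param_def using assms by (intro Max0_upper finite_image_set2) auto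

lemma w_param_upper:
  assumes "finite N" "i \<in> N" "transpose E = E"
  shows "norm (E *v u i) \<le> w_param E u N"
proof -
  have "u i v* E = E *v u i" using vector_transpose_matrix[of "u i" E] assms(3) by simp
  moreover have "norm (u i v* E) \<le> w_param E u N"
    unfolding w_param_def using assms by (intro Max0_upper finite_image_set) auto
  ultimately show ?thesis by simp
qed

text \<open>
  The triples in the definition of \<open>y\<close> are used with the resolvent taken at the eigenvalue of the
  second index.
\<close>

lemma
  fixes u :: "nat \<Rightarrow> real^'n"
  assumes "finite N" "finite S"
  shows y_param_nonneg: "0 \<le> y_param E ev u S N"
    and y_param_upper: "j \<in> N \<Longrightarrow> k \<in> S \<Longrightarrow> k \<in> N \<Longrightarrow> j \<noteq> k \<Longrightarrow>
      \<bar>u j \<bullet> (E *v (\<Sum>l\<in>{1..CARD('n)} - N. ((u l \<bullet> (E *v u k)) / (ev k - ev l)) *\<^sub>R u l))\<bar>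
        \<le> y_param E ev u S N"
proof -
  define F where "F i j k = \<bar>u i \<bullet> ((E ** (\<Sum>l\<in>{1..CARD('n)} - N.
      (1 / (ev k - ev l)) *\<^sub>R outer_product (u l) (u l)) ** E) *v u j)\<bar>" for i j k
  define X where "X = {F i j k | i j k. i \<in> N \<and> j \<in> N \<and> i \<noteq> j \<and> k \<in> S}"
  have y: "y_param E ev u S N = Max0 X" by (simp add: y_param_def X_def F_def)
  have "X \<subseteq> (\<lambda>(i, j, k). F i j k) ` (N \<times> N \<times> S)" by (force simp: X_def)
  then have fin: "finite X" using assms by (auto intro: finite_subset)
  show "0 \<le> y_param E ev u S N"
    unfolding y by (rule Max0_nonneg[OF fin]) (auto simp: X_def F_def)
  assume jk: "j \<in> N" "k \<in> S" "k \<in> N" "j \<noteq> k"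
  then have "F j k k \<le> y_param E ev u S N"
    unfolding y by (intro Max0_upper[OF fin]) (auto simp: X_def)
  moreover have "F j k k = \<bar>u j \<bullet> (E *v (\<Sum>l\<in>{1..CARD('n)} - N.
      ((u l \<bullet> (E *v u k)) / (ev k - ev l)) *\<^sub>R u l))\<bar>"
    by (simp add: F_def sum_matrix_vector_mult outer_product_mult scaleR_matrix_vector_assoc[symmetric]
        flip: matrix_vector_mul_assoc)
  ultimately show "\<bar>u j \<bullet> (E *v (\<Sum>l\<in>{1..CARD('n)} - N.
      ((u l \<bullet> (E *v u k)) / (ev k - ev l)) *\<^sub>R u l))\<bar> \<le> y_param E ev u S N" by simp
qed

text \<open>
  The ball around \<open>a\<close> of radius \<open>infdist a T\<close> is connected and misses \<open>T\<close>.
\<close>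

lemma inside_iff_of_dist_less_infdist:
  fixes a b :: complex
  assumes "dist a b < infdist a T"
  shows "a \<in> inside T \<longleftrightarrow> b \<in> inside T"
proof -
  have "ball a (infdist a T) \<subseteq> - T"
  proof
    fix c assume "c \<in> ball a (infdist a T)"
    then show "c \<in> - T" using infdist_le[of c T a] by auto
  qed
  moreover have "connected (ball a (infdist a T))" by simp
  moreover have "a \<in> ball a (infdist a T)" "b \<in> ball a (infdist a T)"
    using assms le_less_trans[OF zero_le_dist assms] by auto
  ultimately have "connected_component (- T) a b" unfolding connected_component_def by blast
  then show ?thesis
    using inside_same_component connected_component_sym by metis
qed

theorem theorem2p4:
  fixes A E A' :: "real^'n^'n"
    and ev ev' :: "nat \<Rightarrow> real"
    and u u' :: "nat \<Rightarrow> real^'n"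
    and S N S' :: "nat set"
    and p r :: nat
    and \<delta> ev_bar :: real
    and \<gamma> :: "real \<Rightarrow> complex"
  assumes "transpose A = A" and "transpose E = E" and "A' = A + E"
    and "ordered_eigenbasis A ev u"
    and "ordered_eigenbasis A' ev' u'"
    and "S \<noteq> {}" and "S \<subset> {1..CARD('n)}" and "p = card S"
    and "\<delta> = spectral_gap CARD('n) ev S" and "\<delta> > 0"
    and "ev_bar \<ge> \<delta>"
    and "N \<subseteq> {1..CARD('n)}"
    and "\<forall>j \<in> {1..CARD('n)} - N. Min ((\<lambda>i. \<bar>ev j - ev i\<bar>) ` S) > ev_bar"
    and "r = card N"
    and "simple_closed_contour \<gamma>"
    and "\<forall>i \<in> S. complex_of_real (ev i) \<in> inside (path_image \<gamma>)"
    and "\<forall>j \<in> {1..CARD('n)} - S. complex_of_real (ev j) \<notin> inside (path_image \<gamma>)"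
    and "\<forall>i \<in> {1..CARD('n)}. infdist (complex_of_real (ev i)) (path_image \<gamma>) \<ge> \<delta> / 2"
    and "\<forall>j \<in> {1..CARD('n)} - N. infdist (complex_of_real (ev j)) (path_image \<gamma>) \<ge> ev_bar / 2"
    and "S' = {i \<in> {1..CARD('n)}. complex_of_real (ev' i) \<in> inside (path_image \<gamma>)}"
    and "\<delta> \<ge> max (12 * real r * x_param E u N) (144 * real r * (w_param E u N)\<^sup>2 / ev_bar)"
  shows "spectral_norm (spectral_projection u' S' - spectral_projection u S)
           \<le> 12 * sqrt (real p) * relative_norm E ev u S N / \<delta>
             + 12 * sqrt (real p) * spectral_norm E / ev_bar"
proof -
  let ?I = "{1..CARD('n)}"
  define e where "e = spectral_norm E"
  define x y w where "x = x_param E u N" and "y = y_param E ev u S N" and "w = w_param E u N"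
  note \<delta>_pos = \<open>0 < \<delta>\<close> and \<Lambda>_ge = \<open>ev_bar \<ge> \<delta>\<close>
  have \<Lambda>_pos: "0 < ev_bar" using \<delta>_pos \<Lambda>_ge by linarith
  interpret U: orthonormal_basis ?I u by (rule orthonormal_basis_of_eigenbasis) fact
  interpret U': orthonormal_basis ?I u' by (rule orthonormal_basis_of_eigenbasis) fact
  have finS: "finite S" and SI: "S \<subseteq> ?I" and finN: "finite N" and S'I: "S' \<subseteq> ?I"
    using assms(7,12,20) by (auto intro: finite_subset)
  have E_bound: "norm (E *v v) \<le> e * norm v" for v
    unfolding e_def by (rule onorm) (rule matrix_vector_mul_bounded_linear)
  have e0: "0 \<le> e" unfolding e_def by (rule onorm_pos_le) (rule matrix_vector_mul_bounded_linear)
  have far: "ev_bar < \<bar>ev j - ev i\<bar>" if "j \<in> ?I - N" "i \<in> S" for i j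
  proof -
    have "ev_bar < Min ((\<lambda>i. \<bar>ev j - ev i\<bar>) ` S)" using assms(13) that(1) by blast
    then show ?thesis using that finS by (subst (asm) Min_gr_iff) auto
  qed
  have SN: "S \<subseteq> N"
  proof
    fix k assume k: "k \<in> S"
    show "k \<in> N" using far[of k k] k SI \<Lambda>_pos by fastforce
  qed
  have x0: "0 \<le> x"
  proof -
    obtain k where "k \<in> N" using SN \<open>S \<noteq> {}\<close> by blast
    then show ?thesis using x_param_upper[OF finN, of k k u E] by (simp add: x_def)
  qed
  have y0: "0 \<le> y" unfolding y_def by (rule y_param_nonneg[OF finN finS])
  have rel: "relative_norm E ev u S N / \<delta> = sqrt (card N) * (x + y) / \<delta>"
    by (simp add: relative_norm_def x_def y_def distrib_left)
  have rel0: "0 \<le> sqrt (card N) * (x + y) / \<delta>" using x0 y0 \<delta>_pos by simp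
  have \<epsilon>0: "0 \<le> e / ev_bar" using e0 \<Lambda>_pos by simp
  have p1: "1 \<le> sqrt p" using \<open>p = card S\<close> finS \<open>S \<noteq> {}\<close> by (simp add: Suc_leI card_gt_0_iff)
  have diff: "(spectral_projection u' S' - spectral_projection u S) *v v = U'.proj S' v - U.proj S v" for v
    by (simp add: matrix_vector_mult_diff_rdistrib spectral_projection_mult U.proj_def U'.proj_def)
  have side: "\<delta> / 2 \<le> \<bar>ev' i - ev j\<bar>"
    if "i \<in> ?I" "j \<in> ?I" "(i \<in> S') \<noteq> (j \<in> S)" for i j
  proof (rule ccontr)
    assume "\<not> \<delta> / 2 \<le> \<bar>ev' i - ev j\<bar>"
    then have "dist (complex_of_real (ev j)) (complex_of_real (ev' i)) < \<delta> / 2"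
      by (simp add: dist_of_real dist_real_def abs_minus_commute)
    moreover have "\<delta> / 2 \<le> infdist (complex_of_real (ev j)) (path_image \<gamma>)"
      using assms(18) that(2) by blast
    ultimately have "complex_of_real (ev j) \<in> inside (path_image \<gamma>)
        \<longleftrightarrow> complex_of_real (ev' i) \<in> inside (path_image \<gamma>)"
      by (intro inside_iff_of_dist_less_infdist) linarith
    moreover have "complex_of_real (ev j) \<in> inside (path_image \<gamma>) \<longleftrightarrow> j \<in> S"
      using assms(16,17) that(2) by blast
    ultimately show False using assms(20) that by auto
  qed
  have side_far: "ev_bar / 2 \<le> \<bar>ev' i - ev l\<bar>" if "i \<in> S'" "l \<in> ?I - N" for i l
  proof (rule ccontr)
    assume "\<not> ev_bar / 2 \<le> \<bar>ev' i - ev l\<bar>"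
    then have "dist (complex_of_real (ev l)) (complex_of_real (ev' i)) < ev_bar / 2"
      by (simp add: dist_of_real dist_real_def abs_minus_commute)
    moreover have "ev_bar / 2 \<le> infdist (complex_of_real (ev l)) (path_image \<gamma>)"
      using assms(19) that(2) by blast
    ultimately have "complex_of_real (ev l) \<in> inside (path_image \<gamma>)
        \<longleftrightarrow> complex_of_real (ev' i) \<in> inside (path_image \<gamma>)"
      by (intro inside_iff_of_dist_less_infdist) linarith
    moreover have "complex_of_real (ev l) \<notin> inside (path_image \<gamma>)"
      using assms(17) that(2) SN by blast
    ultimately show False using assms(20) that by auto
  qed
  \<comment> \<open>If \<open>E\<close> is large compared with the cut-off, the trivial bound \<open>2\<close> for the difference of two
    projections suffices, because \<open>12 * sqrt p * e / ev_bar \<ge> 2\<close>.\<close>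
  have "norm (U'.proj S' v - U.proj S v)
      \<le> 12 * sqrt p * (sqrt (card N) * (x + y) / \<delta> + e / ev_bar) * norm v" for v
  proof (cases "6 * e \<le> ev_bar")
    case True
    have sym: "(M *v v) \<bullet> w = v \<bullet> (M *v w)" if "transpose M = M" for M :: "real^'n^'n" and v w
      by (metis dot_lmul_matrix that vector_transpose_matrix)
    interpret spectral_perturbation ?I u ?I u' "\<lambda>v. A *v v" "\<lambda>v. E *v v" ev ev' S N S'
      \<delta> ev_bar e x y w
    proof (intro spectral_perturbation.intro spectral_perturbation_axioms.intro)
      show "A *v u i = ev i *\<^sub>R u i" if "i \<in> ?I" for i
        using that assms(4) unfolding ordered_eigenbasis_def by blast
      show "A *v u' i + E *v u' i = ev' i *\<^sub>R u' i" if "i \<in> ?I" for i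
        using that assms(5) \<open>A' = A + E\<close> unfolding ordered_eigenbasis_def
        by (simp flip: matrix_vector_mult_add_rdistrib)
      show "ev_bar \<le> \<bar>ev k - ev l\<bar>" if "k \<in> S" "l \<in> ?I - N" for k l
        using far[OF that(2,1)] by linarith
      show "\<delta> / 2 \<le> \<bar>ev' i - ev k\<bar>" if "i \<in> ?I - S'" "k \<in> S" for i k
        using side[of i k] that SI by blast
      show "\<delta> / 2 \<le> \<bar>ev' i - ev j\<bar>" if "i \<in> S'" "j \<in> ?I - S" for i j
        using side[of i j] that S'I by blast
      show "\<bar>u j \<bullet> (E *v (\<Sum>l\<in>?I - N. ((u l \<bullet> (E *v u k)) / (ev k - ev l)) *\<^sub>R u l))\<bar> \<le> y"
        if "j \<in> N" "k \<in> S" "j \<noteq> k" for j k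
        unfolding y_def using that SN by (intro y_param_upper[OF finN finS]) auto
      show "12 * real (card N) * x \<le> \<delta>" using assms(14,21) by (simp add: x_def)
      have "144 * real (card N) * w\<^sup>2 / ev_bar \<le> \<delta>" using assms(14,21) by (simp add: w_def)
      then show "144 * real (card N) * w\<^sup>2 \<le> \<delta> * ev_bar" using \<Lambda>_pos by (simp add: pos_divide_le_eq)
      show "\<bar>u i \<bullet> (E *v u j)\<bar> \<le> x" if "i \<in> N" "j \<in> N" for i j
        unfolding x_def by (rule x_param_upper[OF finN that])
      show "norm (E *v u i) \<le> w" if "i \<in> N" for i
        unfolding w_def by (rule w_param_upper[OF finN that assms(2)])
    qed (use assms(1,2,6,10-12) SN S'I sym E_bound e0 True y0 side_far
        U.orthonormal_basis_axioms U'.orthonormal_basis_axioms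
        in \<open>auto intro: matrix_vector_mul_linear\<close>)
    have "norm (U'.proj S' v - U.proj S v)
        \<le> 6 * (sqrt p * (sqrt (card N) * (x + y) / \<delta> + e / ev_bar) * norm v)"
      using proj_diff_bound[of v] \<open>p = card S\<close> by (simp add: rel_error_def mult_ac)
    also have "\<dots> \<le> 12 * (sqrt p * (sqrt (card N) * (x + y) / \<delta> + e / ev_bar) * norm v)"
      using rel0 \<epsilon>0 by (intro mult_right_mono mult_nonneg_nonneg add_nonneg_nonneg) auto
    finally show ?thesis by (simp only: mult.assoc)
  next
    case False
    have "norm (U'.proj S' v - U.proj S v) \<le> norm (U'.proj S' v) + norm (U.proj S v)"
      by (rule norm_triangle_ineq4)
    also have "\<dots> \<le> 2 * norm v" using U'.norm_proj_le[OF S'I, of v] U.norm_proj_le[OF SI, of v] by linarith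
    also have "\<dots> \<le> 12 * sqrt p * (sqrt (card N) * (x + y) / \<delta> + e / ev_bar) * norm v"
    proof (rule mult_right_mono)
      have "1 / 6 \<le> e / ev_bar" using False \<Lambda>_pos by (simp add: pos_le_divide_eq)
      then have "1 / 6 \<le> sqrt (card N) * (x + y) / \<delta> + e / ev_bar" using rel0 by linarith
      then have "1 * (1 / 6) \<le> sqrt p * (sqrt (card N) * (x + y) / \<delta> + e / ev_bar)"
        using p1 by (intro mult_mono) auto
      then show "2 \<le> 12 * sqrt p * (sqrt (card N) * (x + y) / \<delta> + e / ev_bar)" by linarith
    qed simp
    finally show ?thesis .
  qed
  then have "spectral_norm (spectral_projection u' S' - spectral_projection u S)
      \<le> 12 * sqrt p * (sqrt (card N) * (x + y) / \<delta> + e / ev_bar)"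
    by (intro onorm_le) (simp add: diff)
  also have "\<dots> = 12 * sqrt p * (relative_norm E ev u S N / \<delta>) + 12 * sqrt p * (e / ev_bar)"
    by (simp only: rel distrib_left)
  finally show ?thesis by (simp add: e_def)
qed

end
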